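(* Let $0<\alpha\le 1$. Let $q,\tilde q$ be real-valued continuous functions on $[0,\pi]$ and $h,H,\tilde h,\tilde H\in\mathbb{R}$. Let $\{\lambda_n\}_{n\ge0}$ be the eigenvalues of the problem $L_\alpha(q,h,H)$: $$-D_x^\alpha D_x^\alpha y+q(x)y=\lambda y,\ 0<x<\pi,\qquad D_x^\alpha y(0)-hy(0)=0,\qquad D_x^\alpha y(\pi)+Hy(\pi)=0,$$ and let $\{\xi_n\}_{n\ge0}$ be the eigenvalues of the problem $L_{\alpha,1}(q,H)$: $$-D_x^\alpha D_x^\alpha y+q(x)y=\lambda y,\ 0<x<\pi,\qquad y(0)=0,\qquad D_x^\alpha y(\pi)+Hy(\pi)=0.$$ Let $\{\tilde\lambda_n\}_{n\ge0}$, $\{\tilde\xi_n\}_{n\ge0}$ be the corresponding eigenvalues for the coefficients $\tilde q,\tilde h,\tilde H$. If $\lambda_n=\tilde\lambda_n$ and $\xi_n=\tilde\xi_n$ for all $n\ge0$, then $q(x)=\tilde q(x)$ a.e. on $[0,\pi]$, $h=\tilde h$ and $H=\tilde H$.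
   Context: $D_x^\alpha$ denotes the conformable fractional derivative of order $\alpha$: for $x>0$, $D^\alpha f(x)=\lim_{\varepsilon\to 0}\frac{f(x+\varepsilon x^{1-\alpha})-f(x)}{\varepsilon}$, and $D^\alpha f(0)=\lim_{x\to0^+}D^\alpha f(x)$ (for differentiable $f$, $D^\alpha f(x)=x^{1-\alpha}f'(x)$). $\lambda$ is a complex spectral parameter. The eigenvalues of each problem are real and simple, and are enumerated in increasing order. *)

theory Defs
  imports "HOL-Analysis.Analysis"
begin

text \<open>Conformable fractional derivative of order alpha of a function on [0,pi] at a point
  x in (0,pi]: the limit of (f (x + e x^(1-alpha)) - f x)/e as e tends to 0, where only
  increments keeping the argument inside [0,pi] are used (so at x = pi it is one-sided).\<close>
definition conf_deriv_at :: "real \<Rightarrow> (real \<Rightarrow> complex) \<Rightarrow> complex \<Rightarrow> real \<Rightarrow> bool" where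
  "conf_deriv_at \<alpha> f d x \<longleftrightarrow>
     ((\<lambda>e. (f (x + e * x powr (1 - \<alpha>)) - f x) / complex_of_real e) \<longlongrightarrow> d)
       (at 0 within {e. 0 \<le> x + e * x powr (1 - \<alpha>) \<and> x + e * x powr (1 - \<alpha>) \<le> pi})"

text \<open>y is a nontrivial solution of  - D^a D^a y + q y = lam y  on (0,pi), with u = D^a y
  (u 0 = D^a y(0) is the right limit of D^a y, encoded by continuity of u on [0,pi]).\<close>
definition conf_sl_solution ::
  "real \<Rightarrow> (real \<Rightarrow> real) \<Rightarrow> complex \<Rightarrow> (real \<Rightarrow> complex) \<Rightarrow> (real \<Rightarrow> complex) \<Rightarrow> bool" where
  "conf_sl_solution \<alpha> q lam y u \<longleftrightarrow>
     (\<exists>x\<in>{0..pi}. y x \<noteq> 0) \<and>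
     continuous_on {0..pi} y \<and> continuous_on {0..pi} u \<and>
     (\<forall>x\<in>{0<..pi}. conf_deriv_at \<alpha> y (u x) x) \<and>
     (\<exists>v. \<forall>x\<in>{0<..<pi}. conf_deriv_at \<alpha> u (v x) x \<and>
            - v x + complex_of_real (q x) * y x = lam * y x)"

definition eig_L :: "real \<Rightarrow> (real \<Rightarrow> real) \<Rightarrow> real \<Rightarrow> real \<Rightarrow> complex set" where
  "eig_L \<alpha> q h H = {lam. \<exists>y u. conf_sl_solution \<alpha> q lam y u \<and>
       u 0 - complex_of_real h * y 0 = 0 \<and> u pi + complex_of_real H * y pi = 0}"

definition eig_L1 :: "real \<Rightarrow> (real \<Rightarrow> real) \<Rightarrow> real \<Rightarrow> complex set" where
  "eig_L1 \<alpha> q H = {lam. \<exists>y u. conf_sl_solution \<alpha> q lam y u \<and>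
       y 0 = 0 \<and> u pi + complex_of_real H * y pi = 0}"

definition enumerates_incr :: "(nat \<Rightarrow> real) \<Rightarrow> complex set \<Rightarrow> bool" where
  "enumerates_incr s E \<longleftrightarrow> strict_mono s \<and> E = complex_of_real ` range s"

end

theory Submission
  imports Defs "HOL-Complex_Analysis.Complex_Analysis"
begin

text \<open>
  The substitution \<open>t = x\<^sup>\<alpha> / \<alpha>\<close> turns the problem into \<open>- y'' + p y = \<lambda> y\<close> on \<open>[0, T]\<close>.
  Let \<open>\<psi>\<close> be the solution with \<open>\<psi>(T) = 1, \<psi>'(T) = - H\<close>; the two spectra are the zero sets of the
  entire functions \<open>\<psi>(0, \<lambda>)\<close> and \<open>\<Delta>(\<lambda>) = \<psi>'(0, \<lambda>) - h \<psi>(0, \<lambda>)\<close>, and these zeros are simple because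
  they are real and \<open>\<integral> \<psi>\<^sup>2 \<noteq> 0\<close> there. With \<open>\<lambda> = k\<^sup>2\<close> one has \<open>\<psi>(0) \<sim> cos kT\<close> and \<open>\<Delta> \<sim> k sin kT\<close>, so the
  relative differences of these functions between the two problems are entire and tend to 0 on
  suitable large squares in the \<open>k\<close>-plane; by the maximum principle they vanish.

  Let \<open>\<phi>, S\<close> be the solutions with initial data \<open>(1, h)\<close> and \<open>(0, 1)\<close> at 0, and let the index 2
  refer to the second problem. Since \<open>\<psi> = \<psi>(0) \<phi> + \<Delta> S\<close> for both problems,
  \<open>\<psi> \<phi>\<^sub>2 - \<phi> \<psi>\<^sub>2 = \<Delta> (S \<phi>\<^sub>2 - \<phi> S\<^sub>2)\<close>; the left side is \<open>O(exp (T |Im k|))\<close>, so the entire function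
  \<open>S \<phi>\<^sub>2 - \<phi> S\<^sub>2\<close> also decays on the squares and is 0. Differentiating and using that the Wronskians
  are 1 gives \<open>\<phi>\<^sup>2 = \<phi>\<^sub>2\<^sup>2\<close>, hence \<open>\<phi> = \<phi>\<^sub>2\<close> for \<open>\<lambda> \<ll> 0\<close>, and the potential and \<open>h\<close> can be read off
  from \<open>\<phi>\<close>. Below, \<open>F\<close> stands for \<open>\<phi>\<close>, and \<open>Y l t\<close> in the uniqueness proof for \<open>\<psi>(T - t)\<close>.
\<close>

section \<open>The linear initial value problem\<close>

text \<open>The equation y'' = Q y as a first-order system. Derivatives are required only in the
  interior, with continuity up to the ends; this matches the conformable problem, whose data at 0
  are limits.\<close>

definition sl_sol ::
  "real \<Rightarrow> (real \<Rightarrow> complex) \<Rightarrow> (real \<Rightarrow> complex) \<Rightarrow> (real \<Rightarrow> complex) \<Rightarrow> bool" where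
  "sl_sol T Q y u \<longleftrightarrow> continuous_on {0..T} y \<and> continuous_on {0..T} u \<and>
     (\<forall>x\<in>{0<..<T}. (y has_vector_derivative u x) (at x) \<and>
                    (u has_vector_derivative Q x * y x) (at x))"

lemma sl_solD:
  assumes "sl_sol T Q y u"
  shows "continuous_on {0..T} y" "continuous_on {0..T} u"
    "\<And>x. x \<in> {0<..<T} \<Longrightarrow> (y has_vector_derivative u x) (at x)"
    "\<And>x. x \<in> {0<..<T} \<Longrightarrow> (u has_vector_derivative Q x * y x) (at x)"
  using assms unfolding sl_sol_def by auto

lemma sl_sol_integral:
  assumes "sl_sol T Q y u" "x \<in> {0..T}"
  shows "(u has_integral (y x - y 0)) {0..x}"
    and "((\<lambda>t. Q t * y t) has_integral (u x - u 0)) {0..x}"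
proof -
  have sub: "{0..x} \<subseteq> {0..T}" using assms(2) by auto
  show "(u has_integral (y x - y 0)) {0..x}"
    by (rule fundamental_theorem_of_calculus_interior)
      (use assms sub in \<open>auto intro: sl_solD continuous_on_subset\<close>)
  show "((\<lambda>t. Q t * y t) has_integral (u x - u 0)) {0..x}"
    by (rule fundamental_theorem_of_calculus_interior)
      (use assms sub in \<open>auto intro: sl_solD continuous_on_subset\<close>)
qed

lemma has_integral_exp_scaled:
  fixes K c x :: real
  assumes "K \<noteq> 0" "0 \<le> x"
  shows "((\<lambda>t. c * exp (K * t)) has_integral (c * (exp (K * x) - 1) / K)) {0..x}"
proof -
  have "((\<lambda>t. c * exp (K * t)) has_integral (c * exp (K * x) / K - c * exp (K * 0) / K)) {0..x}"
    by (rule fundamental_theorem_of_calculus)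
      (use assms in \<open>auto intro!: derivative_eq_intros simp flip: has_real_derivative_iff_has_vector_derivative\<close>)
  then show ?thesis by (simp add: algebra_simps diff_divide_distrib)
qed

lemma norm_has_integral_le:
  fixes f :: "real \<Rightarrow> complex"
  assumes "(f has_integral I) S" "(g has_integral J) S" "\<And>t. t \<in> S \<Longrightarrow> norm (f t) \<le> g t"
  shows "norm I \<le> J"
  using integral_norm_bound_integral[of f S g] assms by (auto simp: has_integral_iff)

lemma continuous_on_Icc_bound:
  fixes f :: "real \<Rightarrow> 'a::real_normed_vector"
  assumes "continuous_on {a..b} f"
  obtains M where "M > 0" "\<And>t. t \<in> {a..b} \<Longrightarrow> norm (f t) \<le> M"
  using compact_imp_bounded[OF compact_continuous_image[OF assms compact_Icc]]
  unfolding bounded_pos by blast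

text \<open>A Gronwall-type estimate from a weighted maximum: under the weight
  \<open>exp (- K * t)\<close> the two integral equations bound the maximum by the initial data plus
  half of itself.\<close>

lemma sl_sol_bound:
  assumes sol: "sl_sol T Q y u" and M: "\<And>t. t \<in> {0..T} \<Longrightarrow> norm (Q t) \<le> M"
    and x: "x \<in> {0..T}"
  shows "norm (y x) + norm (u x) \<le> 2 * (norm (y 0) + norm (u 0)) * exp (2 * (1 + M) * x)"
proof -
  \<comment> \<open>The choice gives \<open>(1 + M) / K = 1 / 2\<close>, where 1 and
    \<open>M\<close> bound the coefficients of y' = u and u' = Q y.\<close>
  define K where "K = 2 * (1 + M)"
  define A where "A = norm (y 0) + norm (u 0)"
  have T: "0 \<le> T" using x by auto
  have M0: "0 \<le> M" using order_trans[OF norm_ge_zero M[of 0]] T by auto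
  have K0: "K > 0" using M0 by (simp add: K_def)
  define g where "g t = exp (- K * t) * (norm (y t) + norm (u t))" for t
  have "continuous_on {0..T} g"
    unfolding g_def by (intro continuous_intros sl_solD[OF sol])
  then obtain s where s: "s \<in> {0..T}" and gs: "\<And>t. t \<in> {0..T} \<Longrightarrow> g t \<le> g s"
    using continuous_attains_sup[of "{0..T}" g] T by auto
  define m where "m = g s"
  have bnd: "norm (y t) + norm (u t) \<le> m * exp (K * t)" if "t \<in> {0..T}" for t
  proof -
    have "(norm (y t) + norm (u t)) = g t * exp (K * t)"
      by (simp add: g_def exp_minus field_simps)
    also have "\<dots> \<le> m * exp (K * t)" using gs[OF that] by (simp add: m_def)
    finally show ?thesis .
  qed
  have m0: "m \<ge> 0" by (simp add: m_def g_def)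
  have main: "norm (y t) + norm (u t) \<le> A + m / 2 * exp (K * t)" if t: "t \<in> {0..T}" for t
  proof -
    have b1: "norm (y r) \<le> m * exp (K * r)" "norm (u r) \<le> m * exp (K * r)"
      if "r \<in> {0..T}" for r
      using bnd[OF that] norm_ge_zero[of "y r"] norm_ge_zero[of "u r"] by linarith+
    have "norm (y t - y 0) \<le> m * (exp (K * t) - 1) / K"
      by (rule norm_has_integral_le[OF sl_sol_integral(1)[OF sol t] has_integral_exp_scaled])
        (use K0 t b1 in auto)
    moreover have "norm (u t - u 0) \<le> (M * m) * (exp (K * t) - 1) / K"
    proof (rule norm_has_integral_le[OF sl_sol_integral(2)[OF sol t] has_integral_exp_scaled])
      fix r assume "r \<in> {0..t}"
      then have r: "r \<in> {0..T}" using t by auto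
      have "norm (Q r) * norm (y r) \<le> M * (m * exp (K * r))"
        by (rule mult_mono) (use M[OF r] b1[OF r] M0 in auto)
      then show "norm (Q r * y r) \<le> M * m * exp (K * r)" by (simp add: norm_mult mult.assoc)
    qed (use K0 t in auto)
    moreover have "m * (exp (K * t) - 1) / K + (M * m) * (exp (K * t) - 1) / K
                    = m / 2 * (exp (K * t) - 1)"
    proof -
      have "(1 + M) / K = 1 / 2" using M0 by (simp add: K_def)
      moreover have "m * e / K + (M * m) * e / K = ((1 + M) / K) * m * e" for e
        by (simp add: field_simps add_divide_distrib)
      ultimately show ?thesis by (simp only:)
    qed
    moreover have "m / 2 * (exp (K * t) - 1) \<le> m / 2 * exp (K * t)"
      using m0 by (intro mult_left_mono) auto
    moreover have "norm (y t) \<le> norm (y 0) + norm (y t - y 0)"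
      "norm (u t) \<le> norm (u 0) + norm (u t - u 0)"
      by (simp_all add: norm_triangle_sub)
    ultimately show ?thesis unfolding A_def by linarith
  qed
  have A0: "A \<ge> 0" by (simp add: A_def)
  \<comment> \<open>At the maximiser \<open>s\<close> the exponentials cancel, which gives
    \<open>m \<le> A + m / 2\<close>; half of \<open>m\<close> is then absorbed.\<close>
  have "m = exp (- K * s) * (norm (y s) + norm (u s))" by (simp add: m_def g_def)
  also have "\<dots> \<le> exp (- K * s) * (A + m / 2 * exp (K * s))"
    using main[OF s] by (intro mult_left_mono) auto
  also have "\<dots> = exp (- K * s) * A + m / 2" by (simp add: algebra_simps exp_minus)
  also have "exp (- K * s) * A \<le> 1 * A"
    using K0 s A0 by (intro mult_right_mono) auto
  finally have "m \<le> 2 * A" by simp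
  then have "m * exp (K * x) \<le> 2 * A * exp (K * x)" by (intro mult_right_mono) auto
  with bnd[OF x] show ?thesis unfolding A_def K_def by linarith
qed

section \<open>Linearity, uniqueness and existence of solutions\<close>

lemma sl_sol_lincomb:
  assumes "sl_sol T Q y u" "sl_sol T Q z v"
  shows "sl_sol T Q (\<lambda>x. a * y x + b * z x) (\<lambda>x. a * u x + b * v x)"
  unfolding sl_sol_def
proof (intro conjI ballI)
  show "continuous_on {0..T} (\<lambda>x. a * y x + b * z x)" "continuous_on {0..T} (\<lambda>x. a * u x + b * v x)"
    by (intro continuous_intros sl_solD[OF assms(1)] sl_solD[OF assms(2)])+
  fix x assume x: "x \<in> {0<..<T}"
  note d = sl_solD(3,4)[OF assms(1) x] sl_solD(3,4)[OF assms(2) x]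
  show "((\<lambda>x. a * y x + b * z x) has_vector_derivative a * u x + b * v x) (at x)"
    by (intro derivative_intros d)
  have "((\<lambda>x. a * u x + b * v x) has_vector_derivative a * (Q x * y x) + b * (Q x * z x)) (at x)"
    by (intro derivative_intros d)
  then show "((\<lambda>x. a * u x + b * v x) has_vector_derivative Q x * (a * y x + b * z x)) (at x)"
    by (simp add: algebra_simps)
qed

lemma sl_sol_cong:
  assumes "sl_sol T Q y u" "\<And>x. x \<in> {0<..<T} \<Longrightarrow> Q x = Q' x"
  shows "sl_sol T Q' y u"
  using assms unfolding sl_sol_def by auto

text \<open>The difference of the solutions has zero initial data, so the a priori bound makes it
  vanish.\<close>

lemma sl_sol_unique:
  assumes "sl_sol T Q y u" "sl_sol T Q z v" and Q: "continuous_on {0..T} Q"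
    and "y 0 = z 0" "u 0 = v 0" and x: "x \<in> {0..T}"
  shows "y x = z x" "u x = v x"
proof -
  obtain M where M: "\<And>t. t \<in> {0..T} \<Longrightarrow> norm (Q t) \<le> M"
    using continuous_on_Icc_bound[OF Q] by metis
  have "sl_sol T Q (\<lambda>x. 1 * y x + (- 1) * z x) (\<lambda>x. 1 * u x + (- 1) * v x)"
    by (rule sl_sol_lincomb) fact+
  from sl_sol_bound[OF this M x] assms(4,5)
  have "norm (y x - z x) + norm (u x - v x) \<le> 0" by simp
  then show "y x = z x" "u x = v x"
    by (metis add_nonneg_eq_0_iff norm_ge_zero order_antisym add_nonneg_nonneg norm_eq_zero right_minus_eq)+
qed

text \<open>This is y'' = Q y with data \<open>a\<close>, \<open>b\<close> integrated twice, its
  kernel x - t split over two integrals. An exponential weight turns the integral operator into a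
  contraction on the whole interval at once, so Banach's fixed point theorem applies.\<close>

lemma volterra_fixpoint:
  fixes Q :: "real \<Rightarrow> complex"
  assumes T: "0 < T" and Q: "continuous_on {0..T} Q"
  shows "\<exists>y. continuous_on {0..T} y \<and>
    (\<forall>x\<in>{0..T}. y x = a + b * of_real x + of_real x * integral {0..x} (\<lambda>t. Q t * y t)
                    - integral {0..x} (\<lambda>t. of_real t * Q t * y t))"
proof -
  obtain M where M: "\<And>t. t \<in> {0..T} \<Longrightarrow> norm (Q t) \<le> M" and M0: "M > 0"
    using continuous_on_Icc_bound[OF Q] by metis
  \<comment> \<open>The kernel times \<open>Q\<close> is at most \<open>T * M\<close> and
    integrating the weight gains \<open>1 / K\<close>, so the contraction constant is
    \<open>T * M / K = 1 / 2\<close>.\<close>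
  define K where "K = 2 * T * M"
  have K0: "K > 0" using T M0 by (simp add: K_def)
  define E where "E t = complex_of_real (exp (K * t))" for t
  have E0: "E t \<noteq> 0" for t by (simp add: E_def)
  \<comment> \<open>Bounded continuous functions live on the whole line; composing with the
    retraction \<open>c\<close> onto [0, T] keeps the operator inside that space.\<close>
  define c where "c x = max 0 (min T x)" for x
  have c_in: "c x \<in> {0..T}" for x using T by (auto simp: c_def)
  have c_id: "c x = x" if "x \<in> {0..T}" for x using that by (auto simp: c_def)
  have c_cont: "continuous_on UNIV c" unfolding c_def by (intro continuous_intros)
  \<comment> \<open>The integral operator conjugated by the weight \<open>E\<close>: a fixed point
    \<open>z\<close> yields the solution \<open>E x * z x\<close>.\<close>
  define V where "V z x = (a + b * of_real x + of_real x * integral {0..x} (\<lambda>t. Q t * (E t * z t))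
                    - integral {0..x} (\<lambda>t. of_real t * Q t * (E t * z t))) / E x" for z :: "real \<Rightarrow> complex" and x
  have E_cont: "continuous_on S E" for S unfolding E_def by (intro continuous_intros)
  have int1: "continuous_on {0..T} (\<lambda>t. Q t * (E t * z t))"
    and int2: "continuous_on {0..T} (\<lambda>t. of_real t * Q t * (E t * z t))"
    if "continuous_on {0..T} z" for z
    using that by (auto intro!: continuous_intros Q E_cont)
  have V_cont: "continuous_on {0..T} (V z)" if "continuous_on {0..T} z" for z
    unfolding V_def using that
    by (intro continuous_intros indefinite_integral_continuous_1 integrable_continuous_interval
         int1 int2 E_cont) (auto simp: E0)
  define F where "F z = Bcontfun (\<lambda>x. V (apply_bcontfun z) (c x))" for z
  have zc: "continuous_on {0..T} (apply_bcontfun z)" for z :: "real \<Rightarrow>\<^sub>C complex"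
    by (rule continuous_on_subset[OF continuous_on_apply_bcontfun]) auto
  have F_in: "(\<lambda>x. V (apply_bcontfun z) (c x)) \<in> bcontfun" for z
  proof -
    have "continuous_on UNIV (\<lambda>x. V (apply_bcontfun z) (c x))"
      by (rule continuous_on_compose2[OF V_cont[OF zc] c_cont]) (use c_in in auto)
    moreover have "bounded (range (\<lambda>x. V (apply_bcontfun z) (c x)))"
      by (rule bounded_subset[OF compact_imp_bounded[OF compact_continuous_image[OF V_cont[OF zc]]]])
        (use c_in in auto)
    ultimately show ?thesis by (simp add: bcontfun_def)
  qed
  have F_app: "apply_bcontfun (F z) x = V (apply_bcontfun z) (c x)" for z x
    unfolding F_def using F_in by (simp add: Bcontfun_inverse)
  have contr: "dist (F z) (F w) \<le> 1 / 2 * dist z w" for z w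
  proof (rule dist_bound)
    fix x0
    define x where "x = c x0"
    have x: "x \<in> {0..T}" using c_in by (simp add: x_def)
    then have sub: "{0..x} \<subseteq> {0..T}" by auto
    define d where "d t = apply_bcontfun z t - apply_bcontfun w t" for t
    have d_le: "norm (d t) \<le> dist z w" for t
      unfolding d_def using dist_bounded[of z t w] by (simp add: dist_norm)
    have dc: "continuous_on {0..T} d" unfolding d_def by (intro continuous_intros zc)
    note ii = integrable_continuous_interval[OF continuous_on_subset[OF int1 sub]]
      integrable_continuous_interval[OF continuous_on_subset[OF int2 sub]]
    have "(V (apply_bcontfun z) x - V (apply_bcontfun w) x) * E x
       = of_real x * integral {0..x} (\<lambda>t. Q t * (E t * d t))
                    - integral {0..x} (\<lambda>t. of_real t * Q t * (E t * d t))"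
      unfolding V_def d_def using E0[of x]
      by (simp add: right_diff_distrib integral_diff ii zc) (simp add: field_simps)
    \<comment> \<open>Merging the integrals restores the kernel x - t, which lies between 0 and
      \<open>T\<close>.\<close>
    also have "\<dots> = integral {0..x} (\<lambda>t. of_real x * (Q t * (E t * d t))
                    - of_real t * Q t * (E t * d t))"
      by (subst integral_diff) (auto intro!: integrable_on_cmult_left ii dc simp: integral_mult_right
            integrable_on_mult_right)
    also have "norm \<dots> \<le> (T * M * dist z w) * (exp (K * x) - 1) / K"
    proof (rule norm_has_integral_le[OF integrable_integral has_integral_exp_scaled])
      fix t assume t: "t \<in> {0..x}"
      then have tT: "t \<in> {0..T}" using x by auto
      have "norm (of_real x * (Q t * (E t * d t)) - of_real t * Q t * (E t * d t))
         = norm (of_real (x - t) * Q t * E t * d t)" by (simp add: algebra_simps)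
      also have "\<dots> = (x - t) * norm (Q t) * exp (K * t) * norm (d t)"
        using t by (simp add: norm_mult E_def del: of_real_diff)
      also have "\<dots> \<le> T * M * exp (K * t) * dist z w"
        using t x M[OF tT] d_le[of t] M0 T by (intro mult_mono) auto
      finally show "norm (of_real x * (Q t * (E t * d t)) - of_real t * Q t * (E t * d t))
         \<le> T * M * dist z w * exp (K * t)" by (simp add: algebra_simps)
    qed (use K0 x in \<open>auto intro!: integrable_diff integrable_on_mult_right ii dc\<close>)
    also have "\<dots> = dist z w / 2 * (exp (K * x) - 1)"
      using M0 T by (simp add: K_def field_simps)
    also have "\<dots> \<le> dist z w / 2 * exp (K * x)" by (intro mult_left_mono) auto
    finally have "norm (V (apply_bcontfun z) x - V (apply_bcontfun w) x) * exp (K * x)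
        \<le> (dist z w / 2) * exp (K * x)"
      by (simp add: norm_mult E_def)
    then have "norm (V (apply_bcontfun z) x - V (apply_bcontfun w) x) \<le> dist z w / 2"
      by (rule mult_right_le_imp_le) simp
    then show "dist (apply_bcontfun (F z) x0) (apply_bcontfun (F w) x0) \<le> 1 / 2 * dist z w"
      by (simp add: F_app x_def dist_norm)
  qed
  have "\<exists>!z. F z = z"
    by (rule banach_fix_type[where c = "1/2"]) (use contr in auto)
  then obtain z where z: "F z = z" by auto
  define y where "y x = E x * apply_bcontfun z x" for x
  have "continuous_on {0..T} y" unfolding y_def by (intro continuous_intros E_cont zc)
  moreover have "y x = a + b * of_real x + of_real x * integral {0..x} (\<lambda>t. Q t * y t)
                    - integral {0..x} (\<lambda>t. of_real t * Q t * y t)" if "x \<in> {0..T}" for x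
  proof -
    have "apply_bcontfun z x = V (apply_bcontfun z) x"
      using F_app[of z x] z c_id[OF that] by simp
    then show ?thesis unfolding y_def V_def using E0[of x] by (simp add: field_simps)
  qed
  ultimately show ?thesis by blast
qed

lemma sl_sol_exists:
  fixes Q :: "real \<Rightarrow> complex"
  assumes T: "0 < T" and Q: "continuous_on {0..T} Q"
  shows "\<exists>y u. sl_sol T Q y u \<and> y 0 = a \<and> u 0 = b"
proof -
  obtain y where yc: "continuous_on {0..T} y" and
    y: "\<And>x. x \<in> {0..T} \<Longrightarrow> y x = a + b * of_real x + of_real x * integral {0..x} (\<lambda>t. Q t * y t)
                    - integral {0..x} (\<lambda>t. of_real t * Q t * y t)"
    using volterra_fixpoint[OF T Q, of a b] by blast
  define u where "u x = b + integral {0..x} (\<lambda>t. Q t * y t)" for x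
  \<comment> \<open>The right side of the integral equation, which agrees with \<open>y\<close> on
    [0, T]. In its derivative the two terms \<open>x * Q x * y x\<close> cancel and \<open>u\<close>
    remains.\<close>
  define w where "w x = a + b * of_real x + of_real x * integral {0..x} (\<lambda>t. Q t * y t)
                    - integral {0..x} (\<lambda>t. of_real t * Q t * y t)" for x
  have c1: "continuous_on {0..T} (\<lambda>t. Q t * y t)"
    and c2: "continuous_on {0..T} (\<lambda>t. of_real t * Q t * y t)"
    by (intro continuous_intros Q yc)+
  have d: "((\<lambda>x. integral {0..x} (\<lambda>t. Q t * y t)) has_vector_derivative Q x * y x) (at x)"
    "((\<lambda>x. integral {0..x} (\<lambda>t. of_real t * Q t * y t)) has_vector_derivative of_real x * Q x * y x) (at x)"
    if "x \<in> {0<..<T}" for x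
    using integral_has_vector_derivative[OF c1, of x] integral_has_vector_derivative[OF c2, of x] that
    by (auto simp: at_within_Icc_at)
  have "sl_sol T Q y u"
    unfolding sl_sol_def
  proof (intro conjI ballI)
    show "continuous_on {0..T} u"
      unfolding u_def by (intro continuous_intros indefinite_integral_continuous_1
          integrable_continuous_interval c1)
    fix x assume x: "x \<in> {0<..<T}"
    have "(w has_vector_derivative (0 + b * 1 + (of_real x * (Q x * y x) + 1 * integral {0..x} (\<lambda>t. Q t * y t))
       - of_real x * Q x * y x)) (at x)"
      unfolding w_def
      by (intro derivative_intros has_vector_derivative_mult d x has_vector_derivative_of_real)
        (auto intro!: derivative_eq_intros)
    then have "(w has_vector_derivative u x) (at x)" by (simp add: u_def algebra_simps)
    then show "(y has_vector_derivative u x) (at x)"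
      by (rule has_vector_derivative_transform_within_open[where S = "{0<..<T}"])
        (use x y in \<open>auto simp: w_def\<close>)
    have "(u has_vector_derivative 0 + Q x * y x) (at x)"
      unfolding u_def by (intro derivative_intros d x)
    then show "(u has_vector_derivative Q x * y x) (at x)" by simp
  qed (rule yc)
  moreover have "y 0 = a" "u 0 = b" using y[of 0] T by (auto simp: u_def)
  ultimately show ?thesis by blast
qed

section \<open>Dependence on the spectral parameter\<close>

text \<open>The initial data are the same for all \<open>l\<close>, so the boundary terms at 0
  cancel when members of one family are compared.\<close>

definition sl_family ::
  "real \<Rightarrow> (real \<Rightarrow> real) \<Rightarrow> complex \<Rightarrow> complex \<Rightarrow>
    (complex \<Rightarrow> real \<Rightarrow> complex) \<Rightarrow> (complex \<Rightarrow> real \<Rightarrow> complex) \<Rightarrow> bool" where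
  "sl_family T p a b Y U \<longleftrightarrow>
     (\<forall>l. sl_sol T (\<lambda>x. of_real (p x) - l) (Y l) (U l) \<and> Y l 0 = a \<and> U l 0 = b)"

lemma sl_familyD:
  assumes "sl_family T p a b Y U"
  shows "sl_sol T (\<lambda>x. of_real (p x) - l) (Y l) (U l)" "Y l 0 = a" "U l 0 = b"
  using assms by (auto simp: sl_family_def)

lemma sl_family_exists:
  assumes "0 < T" "continuous_on {0..T} p"
  shows "\<exists>Y U. sl_family T p a b Y U"
proof -
  have "\<exists>y u. sl_sol T (\<lambda>x. of_real (p x) - l) y u \<and> y 0 = a \<and> u 0 = b" for l
    by (rule sl_sol_exists) (use assms in \<open>auto intro!: continuous_intros\<close>)
  then show ?thesis unfolding sl_family_def by metis
qed

text \<open>Lagrange's identity: the potential terms cancel in the derivative of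
  \<open>y * v - u * z\<close>, which is therefore \<open>(l - m) * y * z\<close>.\<close>

lemma sl_sol_wronskian:
  assumes y: "sl_sol T (\<lambda>x. of_real (p x) - l) y u" and z: "sl_sol T (\<lambda>x. of_real (p x) - m) z v"
    and x: "x \<in> {0..T}"
  shows "y x * v x - u x * z x = y 0 * v 0 - u 0 * z 0 + (l - m) * integral {0..x} (\<lambda>t. y t * z t)"
proof -
  have sub: "{0..x} \<subseteq> {0..T}" using x by auto
  note c = sl_solD(1,2)[OF y] sl_solD(1,2)[OF z]
  have "((\<lambda>t. (l - m) * (y t * z t)) has_integral
      ((y x * v x - u x * z x) - (y 0 * v 0 - u 0 * z 0))) {0..x}"
  proof (rule fundamental_theorem_of_calculus_interior)
    show "continuous_on {0..x} (\<lambda>x. y x * v x - u x * z x)"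
      by (intro continuous_intros continuous_on_subset[OF _ sub] c)
    fix t assume "t \<in> {0<..<x}"
    then have t: "t \<in> {0<..<T}" using x by auto
    note d = sl_solD(3,4)[OF y t] sl_solD(3,4)[OF z t]
    have "((\<lambda>x. y x * v x - u x * z x) has_vector_derivative
       (y t * ((of_real (p t) - m) * z t) + u t * v t) - (u t * v t + (of_real (p t) - l) * y t * z t)) (at t)"
      by (intro derivative_intros has_vector_derivative_mult d)
    then show "((\<lambda>x. y x * v x - u x * z x) has_vector_derivative (l - m) * (y t * z t)) (at t)"
      by (simp add: algebra_simps)
  qed (use x in auto)
  then have "integral {0..x} (\<lambda>t. (l - m) * (y t * z t)) = (y x * v x - u x * z x) - (y 0 * v 0 - u 0 * z 0)"
    by (rule integral_unique)
  then show ?thesis unfolding integral_mult_right by (simp add: algebra_simps)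
qed

lemma sl_sol_wronskian_const:
  assumes "sl_sol T (\<lambda>x. of_real (p x) - l) y u" "sl_sol T (\<lambda>x. of_real (p x) - l) z v" "x \<in> {0..T}"
  shows "y x * v x - u x * z x = y 0 * v 0 - u 0 * z 0"
  using sl_sol_wronskian[OF assms] by simp

text \<open>Expanding the solution at \<open>l\<close> in the fundamental system at \<open>m\<close>.\<close>
lemma sl_family_difference:
  assumes Y: "sl_family T p a b Y U"
    and c: "sl_sol T (\<lambda>x. of_real (p x) - m) c c'" "c 0 = 1" "c' 0 = 0"
    and s: "sl_sol T (\<lambda>x. of_real (p x) - m) s s'" "s 0 = 0" "s' 0 = 1"
    and x: "x \<in> {0..T}"
  shows "Y l x - Y m x = (c x * integral {0..x} (\<lambda>t. Y l t * s t)
                          - s x * integral {0..x} (\<lambda>t. Y l t * c t)) * (l - m)"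
    and "U l x - U m x = (c' x * integral {0..x} (\<lambda>t. Y l t * s t)
                          - s' x * integral {0..x} (\<lambda>t. Y l t * c t)) * (l - m)"
proof -
  note Yl = sl_familyD[OF Y]
  have cs: "c x * s' x - c' x * s x = 1"
    using sl_sol_wronskian_const[OF c(1) s(1) x] c s by simp
  have W: "Y l x * s' x - U l x * s x = a + (l - m) * integral {0..x} (\<lambda>t. Y l t * s t)"
    "Y l x * c' x - U l x * c x = - b + (l - m) * integral {0..x} (\<lambda>t. Y l t * c t)" for l
    using sl_sol_wronskian[OF Yl(1) s(1) x, of l] sl_sol_wronskian[OF Yl(1) c(1) x, of l] c s Yl
    by auto
  \<comment> \<open>Multiplying by the Wronskian \<open>c * s' - c' * s = 1\<close> recovers
    \<open>Y\<close> and \<open>U\<close> from their Wronskians with the fundamental system.\<close>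
  have e: "Y l x = c x * (Y l x * s' x - U l x * s x) - s x * (Y l x * c' x - U l x * c x)"
    "U l x = c' x * (Y l x * s' x - U l x * s x) - s' x * (Y l x * c' x - U l x * c x)" for l
    using arg_cong[OF cs, of "\<lambda>r. Y l x * r"] arg_cong[OF cs, of "\<lambda>r. U l x * r"]
    by (simp_all add: algebra_simps)
  have "Y l x = c x * (a + (l - m) * integral {0..x} (\<lambda>t. Y l t * s t))
           - s x * (- b + (l - m) * integral {0..x} (\<lambda>t. Y l t * c t))"
    "U l x = c' x * (a + (l - m) * integral {0..x} (\<lambda>t. Y l t * s t))
           - s' x * (- b + (l - m) * integral {0..x} (\<lambda>t. Y l t * c t))" for l
    by (subst e, simp only: W)+
  note e' = this
  \<comment> \<open>At the parameter \<open>m\<close> the integrals in \<open>e'\<close> drop out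
    because of their factor \<open>l - m\<close>; the terms in \<open>a\<close> and \<open>b\<close>
    cancel.\<close>
  show "Y l x - Y m x = (c x * integral {0..x} (\<lambda>t. Y l t * s t)
                          - s x * integral {0..x} (\<lambda>t. Y l t * c t)) * (l - m)"
    by (subst (1 2) e') (simp add: algebra_simps)
  show "U l x - U m x = (c' x * integral {0..x} (\<lambda>t. Y l t * s t)
                          - s' x * integral {0..x} (\<lambda>t. Y l t * c t)) * (l - m)"
    by (subst (1 2) e') (simp add: algebra_simps)
qed

text \<open>Over the unit disc about \<open>m\<close> the coefficients \<open>p - l\<close> share
  one bound, so the a priori estimate is uniform in \<open>l\<close>.\<close>

lemma sl_family_local_bound:
  assumes p: "continuous_on {0..T} p" and Y: "sl_family T p a b Y U"
  obtains B where "B > 0" "\<And>l x. l \<in> cball m 1 \<Longrightarrow> x \<in> {0..T} \<Longrightarrow> norm (Y l x) \<le> B"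
proof -
  obtain P where P0: "P > 0" and P: "\<And>t. t \<in> {0..T} \<Longrightarrow> norm (p t) \<le> P"
    using continuous_on_Icc_bound[OF p] by metis
  define M where "M = P + (norm m + 1)"
  have M0: "M > 0" unfolding M_def using P0 norm_ge_zero[of m] by linarith
  define B where "B = 2 * (norm a + norm b) * exp (2 * (1 + M) * T) + 1"
  have "norm (Y l x) \<le> B" if l: "l \<in> cball m 1" and x: "x \<in> {0..T}" for l x
  proof -
    have nl: "norm l \<le> norm m + 1"
      using l norm_triangle_ineq2[of l m] by (simp add: dist_norm norm_minus_commute)
    have "norm (Y l x) + norm (U l x) \<le> 2 * (norm (Y l 0) + norm (U l 0)) * exp (2 * (1 + M) * x)"
    proof (rule sl_sol_bound[OF sl_familyD(1)[OF Y] _ x])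
      fix t assume "t \<in> {0..T}"
      then show "norm (complex_of_real (p t) - l) \<le> M"
        using P[of t] nl norm_triangle_ineq4[of "complex_of_real (p t)" l] by (simp add: M_def)
    qed
    also have "\<dots> \<le> 2 * (norm (Y l 0) + norm (U l 0)) * exp (2 * (1 + M) * T)"
      using x M0 by (intro mult_left_mono) auto
    finally have "norm (Y l x) + norm (U l x) \<le> B - 1"
      unfolding B_def by (simp add: sl_familyD(2,3)[OF Y])
    then show ?thesis using norm_ge_zero[of "U l x"] by linarith
  qed
  moreover have "B > 0" unfolding B_def by (intro add_nonneg_pos) auto
  ultimately show ?thesis using that by blast
qed

text \<open>In the difference formula the factor of \<open>l - m\<close> is bounded, because
  \<open>Y l\<close> is bounded uniformly for \<open>l\<close> near \<open>m\<close> and the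
  fundamental system at \<open>m\<close> is fixed.\<close>

lemma sl_family_lipschitz:
  assumes T: "0 < T" and p: "continuous_on {0..T} p" and Y: "sl_family T p a b Y U"
  obtains L where "L > 0"
    "\<And>l x. l \<in> cball m 1 \<Longrightarrow> x \<in> {0..T} \<Longrightarrow> norm (Y l x - Y m x) \<le> L * norm (l - m)"
proof -
  obtain C C' where C: "sl_family T p 1 0 C C'" using sl_family_exists[OF T p] by blast
  obtain S S' where S: "sl_family T p 0 1 S S'" using sl_family_exists[OF T p] by blast
  note c = sl_familyD[OF C, of m] and s = sl_familyD[OF S, of m]
  obtain B where B0: "B > 0" and B: "\<And>l x. l \<in> cball m 1 \<Longrightarrow> x \<in> {0..T} \<Longrightarrow> norm (Y l x) \<le> B"
    using sl_family_local_bound[OF p Y] by metis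
  obtain N1 where N10: "N1 > 0" and N1: "\<And>x. x \<in> {0..T} \<Longrightarrow> norm (C m x) \<le> N1"
    using continuous_on_Icc_bound[OF sl_solD(1)[OF c(1)]] by metis
  obtain N2 where N20: "N2 > 0" and N2: "\<And>x. x \<in> {0..T} \<Longrightarrow> norm (S m x) \<le> N2"
    using continuous_on_Icc_bound[OF sl_solD(1)[OF s(1)]] by metis
  have I: "norm (integral {0..x} (\<lambda>t. Y l t * Z t)) \<le> B * N * T"
    if l: "l \<in> cball m 1" and x: "x \<in> {0..T}" and Z: "continuous_on {0..T} Z"
      and N: "\<And>t. t \<in> {0..T} \<Longrightarrow> norm (Z t) \<le> N" "N > 0" for l x Z N
  proof -
    have sub: "{0..x} \<subseteq> {0..T}" using x by auto
    have "norm (integral {0..x} (\<lambda>t. Y l t * Z t)) \<le> B * N * (x - 0)"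
    proof (rule integral_bound)
      show "continuous_on {0..x} (\<lambda>t. Y l t * Z t)"
        by (intro continuous_intros continuous_on_subset[OF _ sub] Z sl_solD(1)[OF sl_familyD(1)[OF Y]])
      fix t assume "t \<in> {0..x}"
      then show "norm (Y l t * Z t) \<le> B * N"
        using B[OF l, of t] N(1)[of t] B0 sub unfolding norm_mult by (intro mult_mono) auto
    qed (use x in auto)
    also have "\<dots> \<le> B * N * T" using x B0 N(2) by (intro mult_left_mono) auto
    finally show ?thesis .
  qed
  define L where "L = 2 * (N1 * (B * N2 * T))"
  have "norm (Y l x - Y m x) \<le> L * norm (l - m)" if l: "l \<in> cball m 1" and x: "x \<in> {0..T}" for l x
  proof -
    have "norm (C m x * integral {0..x} (\<lambda>t. Y l t * S m t)) \<le> N1 * (B * N2 * T)"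
      unfolding norm_mult
      by (intro mult_mono N1 x I l sl_solD(1)[OF s(1)] N2) (use N10 N20 in auto)
    moreover have "norm (S m x * integral {0..x} (\<lambda>t. Y l t * C m t)) \<le> N2 * (B * N1 * T)"
      unfolding norm_mult
      by (intro mult_mono N2 x I l sl_solD(1)[OF c(1)] N1) (use N10 N20 in auto)
    ultimately have "norm (C m x * integral {0..x} (\<lambda>t. Y l t * S m t)
                - S m x * integral {0..x} (\<lambda>t. Y l t * C m t)) \<le> L"
      unfolding L_def by (intro order_trans[OF norm_triangle_ineq4]) (simp add: algebra_simps)
    then have "norm ((C m x * integral {0..x} (\<lambda>t. Y l t * S m t)
                - S m x * integral {0..x} (\<lambda>t. Y l t * C m t)) * (l - m)) \<le> L * norm (l - m)"
      unfolding norm_mult by (intro mult_right_mono) auto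
    then show ?thesis by (simp add: sl_family_difference(1)[OF Y c s x])
  qed
  moreover have "L > 0" unfolding L_def using N10 N20 B0 T by simp
  ultimately show ?thesis using that by blast
qed

text \<open>The Lipschitz bound is uniform in the space variable and hence passes under the
  integral.\<close>

lemma sl_family_integral_isCont:
  assumes T: "0 < T" and p: "continuous_on {0..T} p" and Y: "sl_family T p a b Y U"
    and x: "x \<in> {0..T}" and Z: "continuous_on {0..T} Z"
  shows "isCont (\<lambda>l. integral {0..x} (\<lambda>t. Y l t * Z t)) m"
proof -
  obtain L where L0: "L > 0" and
    L: "\<And>l x. l \<in> cball m 1 \<Longrightarrow> x \<in> {0..T} \<Longrightarrow> norm (Y l x - Y m x) \<le> L * norm (l - m)"
    using sl_family_lipschitz[OF T p Y] by metis
  obtain N where N0: "N > 0" and N: "\<And>x. x \<in> {0..T} \<Longrightarrow> norm (Z x) \<le> N"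
    using continuous_on_Icc_bound[OF Z] by metis
  have sub: "{0..x} \<subseteq> {0..T}" using x by auto
  have c: "continuous_on {0..x} (\<lambda>t. Y l t * Z t)" for l
    by (intro continuous_intros continuous_on_subset[OF _ sub] Z sl_solD(1)[OF sl_familyD(1)[OF Y]])
  have est: "norm (integral {0..x} (\<lambda>t. Y l t * Z t) - integral {0..x} (\<lambda>t. Y m t * Z t))
      \<le> L * norm (l - m) * N * x" if l: "l \<in> cball m 1" for l
  proof -
    have "integral {0..x} (\<lambda>t. Y l t * Z t) - integral {0..x} (\<lambda>t. Y m t * Z t)
        = integral {0..x} (\<lambda>t. Y l t * Z t - Y m t * Z t)"
      by (intro integral_diff[symmetric] integrable_continuous_interval c)
    also have "norm \<dots> \<le> L * norm (l - m) * N * (x - 0)"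
    proof (rule integral_bound)
      fix t assume "t \<in> {0..x}"
      then show "norm (Y l t * Z t - Y m t * Z t) \<le> L * norm (l - m) * N"
        using L[OF l, of t] N[of t] L0 sub unfolding left_diff_distrib[symmetric] norm_mult
        by (intro mult_mono) auto
    qed (use x in \<open>auto intro!: continuous_intros c\<close>)
    finally show ?thesis by simp
  qed
  show ?thesis unfolding isCont_def
  proof (rule Lim_transform_bound[THEN Lim_null[THEN iffD2], rotated])
    show "((\<lambda>l. L * norm (l - m) * N * x) \<longlongrightarrow> 0) (at m)"
      by (rule tendsto_eq_intros refl | simp)+
    have "\<forall>\<^sub>F l in at m. l \<in> ball m 1"
      by (rule eventually_at_in_open') auto
    then show "\<forall>\<^sub>F l in at m. norm (integral {0..x} (\<lambda>t. Y l t * Z t) - integral {0..x} (\<lambda>t. Y m t * Z t))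
       \<le> norm (L * norm (l - m) * N * x)"
    proof eventually_elim
      case (elim l)
      then have "l \<in> cball m 1" by auto
      from est[OF this] show ?case by (auto intro: order_trans[OF _ abs_ge_self])
    qed
  qed
qed

text \<open>Caratheodory's criterion: the difference formula exhibits the increment as
  \<open>l - m\<close> times a function of \<open>l\<close> that is continuous at
  \<open>m\<close>.\<close>

lemma sl_family_differentiable:
  assumes T: "0 < T" and p: "continuous_on {0..T} p" and Y: "sl_family T p a b Y U" and x: "x \<in> {0..T}"
  shows "\<exists>D. ((\<lambda>l. Y l x) has_field_derivative D) (at m)"
    and "\<exists>D. ((\<lambda>l. U l x) has_field_derivative D) (at m)"
proof -
  obtain C C' where C: "sl_family T p 1 0 C C'" using sl_family_exists[OF T p] by blast
  obtain S S' where S: "sl_family T p 0 1 S S'" using sl_family_exists[OF T p] by blast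
  note c = sl_familyD[OF C, of m] and s = sl_familyD[OF S, of m]
  note ic = sl_family_integral_isCont[OF T p Y x sl_solD(1)[OF s(1)]]
     sl_family_integral_isCont[OF T p Y x sl_solD(1)[OF c(1)]]
  show "\<exists>D. ((\<lambda>l. Y l x) has_field_derivative D) (at m)"
    unfolding CARAT_DERIV
    by (rule exI)+ (auto intro!: sl_family_difference(1)[OF Y c s x] continuous_intros ic)
  show "\<exists>D. ((\<lambda>l. U l x) has_field_derivative D) (at m)"
    unfolding CARAT_DERIV
    by (rule exI)+ (auto intro!: sl_family_difference(2)[OF Y c s x] continuous_intros ic)
qed

lemma sl_family_holomorphic:
  assumes "0 < T" "continuous_on {0..T} p" "sl_family T p a b Y U" "x \<in> {0..T}"
  shows "(\<lambda>l. Y l x) holomorphic_on A" "(\<lambda>l. U l x) holomorphic_on A"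
  unfolding holomorphic_on_def field_differentiable_def
  using sl_family_differentiable[OF assms] has_field_derivative_at_within by blast+

text \<open>The left side is the derivative at \<open>m\<close> of the Wronskian of
  \<open>Y l\<close> with the fixed solution \<open>Y m\<close>. Lagrange's identity writes that
  Wronskian as \<open>l - m\<close> times an integral, so its derivative is the integral at
  \<open>l = m\<close>.\<close>

lemma sl_family_derivative_wronskian:
  assumes T: "0 < T" and p: "continuous_on {0..T} p" and Y: "sl_family T p a b Y U" and x: "x \<in> {0..T}"
  shows "deriv (\<lambda>l. Y l x) m * U m x - deriv (\<lambda>l. U l x) m * Y m x
           = integral {0..x} (\<lambda>t. Y m t * Y m t)"
proof -
  note dY = sl_family_differentiable[OF T p Y x]
  have "((\<lambda>l. Y l x * U m x - U l x * Y m x) has_field_derivative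
      deriv (\<lambda>l. Y l x) m * U m x - deriv (\<lambda>l. U l x) m * Y m x) (at m)"
    using dY by (intro derivative_intros DERIV_cmult_right DERIV_deriv_iff_field_differentiable[THEN iffD2])
      (auto simp: field_differentiable_def)
  moreover have "((\<lambda>l. Y l x * U m x - U l x * Y m x) has_field_derivative
      integral {0..x} (\<lambda>t. Y m t * Y m t)) (at m)"
    unfolding CARAT_DERIV
  proof (intro exI conjI allI)
    fix l
    show "Y l x * U m x - U l x * Y m x - (Y m x * U m x - U m x * Y m x)
      = integral {0..x} (\<lambda>t. Y l t * Y m t) * (l - m)"
      using sl_sol_wronskian[OF sl_familyD(1)[OF Y, of l] sl_familyD(1)[OF Y, of m] x] sl_familyD(2,3)[OF Y]
      by simp
    show "isCont (\<lambda>l. integral {0..x} (\<lambda>t. Y l t * Y m t)) m"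
      by (rule sl_family_integral_isCont[OF T p Y x]) (rule sl_solD(1)[OF sl_familyD(1)[OF Y]])
  qed auto
  ultimately show ?thesis by (rule DERIV_unique)
qed

text \<open>For a real parameter the conjugate solves the same equation with the same real data, and
  uniqueness applies.\<close>

lemma sl_family_real:
  assumes T: "0 < T" and p: "continuous_on {0..T} p"
    and Y: "sl_family T p (of_real a) (of_real b) Y U" and x: "x \<in> {0..T}"
  shows "cnj (Y (of_real r) x) = Y (of_real r) x"
proof -
  note y = sl_familyD[OF Y, of "of_real r"]
  have "sl_sol T (\<lambda>x. of_real (p x) - of_real r) (\<lambda>x. cnj (Y (of_real r) x)) (\<lambda>x. cnj (U (of_real r) x))"
    unfolding sl_sol_def
  proof (intro conjI ballI)
    fix x assume x: "x \<in> {0<..<T}"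
    show "((\<lambda>x. cnj (Y (of_real r) x)) has_vector_derivative cnj (U (of_real r) x)) (at x)"
      using sl_solD(3)[OF y(1) x] by (rule has_vector_derivative_cnj)
    show "((\<lambda>x. cnj (U (of_real r) x)) has_vector_derivative
        (complex_of_real (p x) - of_real r) * cnj (Y (of_real r) x)) (at x)"
      using has_vector_derivative_cnj[OF sl_solD(4)[OF y(1) x]] by simp
  qed (intro continuous_intros sl_solD[OF y(1)])+
  then show ?thesis
    by (rule sl_sol_unique(1)[OF _ y(1) _ _ _ x]) (use y p in \<open>auto intro!: continuous_intros\<close>)
qed

text \<open>The integrand is the square of a real solution; a zero integral would force the solution
  to vanish, also at 0, where it equals \<open>a\<close>.\<close>

lemma sl_family_square_integral_nonzero:
  assumes T: "0 < T" and p: "continuous_on {0..T} p"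
    and Y: "sl_family T p (of_real a) (of_real b) Y U" and a: "a \<noteq> 0"
  shows "integral {0..T} (\<lambda>t. Y (of_real r) t * Y (of_real r) t) \<noteq> 0"
proof
  define f where "f = Y (of_real r)"
  have fc: "continuous_on {0..T} f"
    unfolding f_def by (rule sl_solD(1)[OF sl_familyD(1)[OF Y]])
  assume 0: "integral {0..T} (\<lambda>t. Y (of_real r) t * Y (of_real r) t) = 0"
  have "integral {0..T} (\<lambda>t. complex_of_real ((norm (f t))\<^sup>2)) = integral {0..T} (\<lambda>t. f t * f t)"
  proof (rule integral_cong)
    fix t assume "t \<in> {0..T}"
    from sl_family_real[OF T p Y this, of r]
    show "complex_of_real ((norm (f t))\<^sup>2) = f t * f t"
      unfolding f_def complex_norm_square by metis
  qed
  then have "integral {0..T} (\<lambda>t. complex_of_real ((norm (f t))\<^sup>2)) = 0" using 0 by (simp add: f_def)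
  moreover have "((\<lambda>t. complex_of_real ((norm (f t))\<^sup>2)) has_integral
      complex_of_real (integral {0..T} (\<lambda>t. (norm (f t))\<^sup>2))) {0..T}"
    by (intro has_integral_of_real integrable_integral integrable_continuous_interval continuous_intros fc)
  ultimately have "integral {0..T} (\<lambda>t. (norm (f t))\<^sup>2) = 0"
    by (metis integral_unique of_real_eq_0_iff)
  then have "\<forall>t\<in>{0..T}. (norm (f t))\<^sup>2 = 0"
    using T by (subst (asm) integral_eq_0_iff) (auto intro!: continuous_intros fc)
  then have "f 0 = 0" using T by auto
  then show False using sl_familyD(2)[OF Y] a by (simp add: f_def)
qed

text \<open>At a double zero the nonzero vector (A, B) would be annihilated by the matrix with rows
  \<open>(Y, U)\<close> and their derivatives in \<open>l\<close>; up to sign its determinant is the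
  nonzero integral of the squared solution.\<close>

lemma sl_family_simple_zero:
  assumes T: "0 < T" and p: "continuous_on {0..T} p"
    and Y: "sl_family T p (of_real a) (of_real b) Y U" and a: "a \<noteq> 0"
    and AB: "A \<noteq> 0 \<or> B \<noteq> 0" and zero: "A * Y (of_real r) T + B * U (of_real r) T = 0"
  shows "deriv (\<lambda>l. A * Y l T + B * U l T) (of_real r) \<noteq> 0"
proof
  have TT: "T \<in> {0..T}" using T by auto
  let ?m = "complex_of_real r"
  define d1 d2 where "d1 = deriv (\<lambda>l. Y l T) ?m" and "d2 = deriv (\<lambda>l. U l T) ?m"
  have "((\<lambda>l. A * Y l T + B * U l T) has_field_derivative A * d1 + B * d2) (at ?m)"
    unfolding d1_def d2_def using sl_family_differentiable[OF T p Y TT]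
    by (intro derivative_intros DERIV_cmult DERIV_deriv_iff_field_differentiable[THEN iffD2])
      (auto simp: field_differentiable_def)
  moreover assume "deriv (\<lambda>l. A * Y l T + B * U l T) ?m = 0"
  ultimately have d: "A * d1 + B * d2 = 0" by (metis DERIV_imp_deriv)
  define y u where "y = Y ?m T" and "u = U ?m T"
  have z: "A * y + B * u = 0" using zero by (simp add: y_def u_def)
  \<comment> \<open>Cramer's rule: the determinant times \<open>A\<close> or \<open>B\<close> is a
    combination of the two vanishing forms.\<close>
  have "A * (d1 * u - d2 * y) = (A * d1 + B * d2) * u - d2 * (A * y + B * u)"
    "B * (d1 * u - d2 * y) = d1 * (A * y + B * u) - (A * d1 + B * d2) * y"
    by (simp_all add: algebra_simps)
  then have "d1 * u - d2 * y = 0" using AB d z by auto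
  then show False
    using sl_family_derivative_wronskian[OF T p Y TT, of ?m] sl_family_square_integral_nonzero[OF T p Y a, of r]
    by (simp add: d1_def d2_def y_def u_def)
qed

section \<open>Asymptotics\<close>

lemma norm_cos_le_exp_Im: "norm (cos z) \<le> exp \<bar>Im z\<bar>"
  and norm_sin_le_exp_Im: "norm (sin z) \<le> exp \<bar>Im z\<bar>"
proof -
  have e: "norm (exp (\<i> * z)) \<le> exp \<bar>Im z\<bar>" "norm (exp (- (\<i> * z))) \<le> exp \<bar>Im z\<bar>"
    by (auto simp: norm_exp_eq_Re)
  have "norm (exp (\<i> * z) + exp (- (\<i> * z))) \<le> 2 * exp \<bar>Im z\<bar>"
    using e norm_triangle_ineq[of "exp (\<i> * z)" "exp (- (\<i> * z))"] by linarith
  then show "norm (cos z) \<le> exp \<bar>Im z\<bar>"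
    by (simp add: cos_exp_eq norm_divide)
  have "norm (exp (\<i> * z) - exp (- (\<i> * z))) \<le> 2 * exp \<bar>Im z\<bar>"
    using e norm_triangle_ineq4[of "exp (\<i> * z)" "exp (- (\<i> * z))"] by linarith
  then show "norm (sin z) \<le> exp \<bar>Im z\<bar>"
    by (simp add: sin_exp_eq norm_divide norm_mult)
qed

text \<open>Uses |cos z|^2 = cos^2 (Re z) + sinh^2 (Im z). In the first case this is cosh^2 (Im z);
  in the second the sinh term alone is large enough.\<close>

lemma norm_cos_ge_exp_Im:
  assumes "\<bar>cos (Re z)\<bar> = 1 \<or> 1 \<le> \<bar>Im z\<bar>"
  shows "exp \<bar>Im z\<bar> / 4 \<le> norm (cos z)"
proof -
  define e where "e = exp \<bar>Im z\<bar>"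
  have e1: "e \<ge> 1" by (simp add: e_def)
  have "(norm (cos z))\<^sup>2 = (cos (Re z))\<^sup>2 + (exp (Im z) - inverse (exp (Im z)))\<^sup>2 / 4"
    by (rule norm_cos_squared)
  also have "(exp (Im z) - inverse (exp (Im z)))\<^sup>2 = (e - inverse e)\<^sup>2"
    by (auto simp: e_def abs_if exp_minus power2_commute)
  finally have n: "(norm (cos z))\<^sup>2 = (cos (Re z))\<^sup>2 + (e - inverse e)\<^sup>2 / 4" .
  have "(e / 4)\<^sup>2 \<le> (norm (cos z))\<^sup>2"
    using assms
  proof
    assume "\<bar>cos (Re z)\<bar> = 1"
    then have "(cos (Re z))\<^sup>2 = 1" by (metis power2_abs one_power2)
    then have "(norm (cos z))\<^sup>2 = (e + inverse e)\<^sup>2 / 4"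
      using n e1 by (simp add: power2_eq_square field_simps)
    moreover have "e\<^sup>2 \<le> (e + inverse e)\<^sup>2" using e1 by (intro power_mono) auto
    ultimately show ?thesis by (simp add: power_divide) (smt (verit) zero_le_power2)
  next
    assume "1 \<le> \<bar>Im z\<bar>"
    then have "1 + 1 \<le> e" unfolding e_def using exp_ge_add_one_self[of "\<bar>Im z\<bar>"] by linarith
    then have "inverse e \<le> e / 2"
      using mult_mono[of 2 e 1 e] by (simp add: field_simps)
    then have "(e / 2)\<^sup>2 \<le> (e - inverse e)\<^sup>2" using e1 by (intro power_mono) auto
    then have "(e / 2)\<^sup>2 / 4 \<le> (norm (cos z))\<^sup>2" using n by (simp add: add_increasing)
    then show ?thesis by (simp add: power_divide)
  qed
  then show ?thesis unfolding e_def[symmetric] by (rule power2_le_imp_le) simp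
qed

lemma norm_sin_ge_exp_Im:
  assumes "\<bar>sin (Re z)\<bar> = 1 \<or> 1 \<le> \<bar>Im z\<bar>"
  shows "exp \<bar>Im z\<bar> / 4 \<le> norm (sin z)"
  using norm_cos_ge_exp_Im[of "of_real pi / 2 - z"] assms
  by (simp add: sin_cos_eq)

text \<open>Variation of constants around the free equation y'' = - k^2 y, with \<open>p * y\<close>
  as the inhomogeneity.\<close>

lemma sl_sol_volterra:
  assumes y: "sl_sol T (\<lambda>x. of_real (p x) - k\<^sup>2) y u" and k: "k \<noteq> 0" and x: "x \<in> {0..T}"
  shows "((\<lambda>t. sin (k * (of_real x - of_real t)) / k * (of_real (p t) * y t)) has_integral
      (y x - (y 0 * cos (k * of_real x) + u 0 * (sin (k * of_real x) / k)))) {0..x}"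
    and "((\<lambda>t. cos (k * (of_real x - of_real t)) * (of_real (p t) * y t)) has_integral
      (u x - (u 0 * cos (k * of_real x) - y 0 * (k * sin (k * of_real x))))) {0..x}"
proof -
  have sub: "{0..x} \<subseteq> {0..T}" using x by auto
  note c = continuous_on_subset[OF sl_solD(1)[OF y] sub] continuous_on_subset[OF sl_solD(2)[OF y] sub]
  have dcos: "((\<lambda>t. cos (k * (of_real x - of_real t))) has_vector_derivative
          k * sin (k * (of_real x - of_real t))) (at t)"
    and dsin: "((\<lambda>t. sin (k * (of_real x - of_real t))) has_vector_derivative
          - k * cos (k * (of_real x - of_real t))) (at t)" for t
    by (rule has_vector_derivative_real_field; auto intro!: derivative_eq_intros)+
  \<comment> \<open>This primitive moves from the free solution with the given data, at
    \<open>t = 0\<close>, to \<open>y x\<close>, at \<open>t = x\<close>; in its derivative the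
    terms with \<open>k\<^sup>2\<close> cancel.\<close>
  let ?g = "\<lambda>t. sin (k * (of_real x - of_real t)) / k * u t + cos (k * (of_real x - of_real t)) * y t"
  have "((\<lambda>t. sin (k * (of_real x - of_real t)) / k * (of_real (p t) * y t)) has_integral
      (?g x - ?g 0)) {0..x}"
  proof (rule fundamental_theorem_of_calculus_interior)
    fix t assume "t \<in> {0<..<x}"
    then have t: "t \<in> {0<..<T}" using x by auto
    note d = sl_solD(3,4)[OF y t]
    have "(?g has_vector_derivative
       (sin (k * (of_real x - of_real t)) / k * ((of_real (p t) - k\<^sup>2) * y t)
        + (- k * cos (k * (of_real x - of_real t))) / k * u t)
       + (cos (k * (of_real x - of_real t)) * u t + k * sin (k * (of_real x - of_real t)) * y t)) (at t)"
      by (intro derivative_intros has_vector_derivative_mult has_vector_derivative_divide d dcos dsin)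
    then show "(?g has_vector_derivative sin (k * (of_real x - of_real t)) / k * (of_real (p t) * y t)) (at t)"
      using k by (simp add: field_simps power2_eq_square)
  qed (use x k in \<open>auto intro!: continuous_intros c\<close>)
  then show "((\<lambda>t. sin (k * (of_real x - of_real t)) / k * (of_real (p t) * y t)) has_integral
      (y x - (y 0 * cos (k * of_real x) + u 0 * (sin (k * of_real x) / k)))) {0..x}"
    by (simp add: algebra_simps)
  \<comment> \<open>The derivative of \<open>?g\<close> with respect to \<open>x\<close>; its value
    at \<open>t = x\<close> is \<open>u x\<close>.\<close>
  let ?f = "\<lambda>t. cos (k * (of_real x - of_real t)) * u t - k * sin (k * (of_real x - of_real t)) * y t"
  have "((\<lambda>t. cos (k * (of_real x - of_real t)) * (of_real (p t) * y t)) has_integral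
      (?f x - ?f 0)) {0..x}"
  proof (rule fundamental_theorem_of_calculus_interior)
    fix t assume "t \<in> {0<..<x}"
    then have t: "t \<in> {0<..<T}" using x by auto
    note d = sl_solD(3,4)[OF y t]
    have "(?f has_vector_derivative
       (cos (k * (of_real x - of_real t)) * ((of_real (p t) - k\<^sup>2) * y t)
        + (k * sin (k * (of_real x - of_real t))) * u t)
       - (k * sin (k * (of_real x - of_real t)) * u t + k * (- k * cos (k * (of_real x - of_real t))) * y t)) (at t)"
      by (intro derivative_intros has_vector_derivative_mult has_vector_derivative_mult_right d dcos dsin)
    then show "(?f has_vector_derivative cos (k * (of_real x - of_real t)) * (of_real (p t) * y t)) (at t)"
      by (simp add: algebra_simps power2_eq_square)
  qed (use x k in \<open>auto intro!: continuous_intros c\<close>)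
  then show "((\<lambda>t. cos (k * (of_real x - of_real t)) * (of_real (p t) * y t)) has_integral
      (u x - (u 0 * cos (k * of_real x) - y 0 * (k * sin (k * of_real x))))) {0..x}"
    by (simp add: algebra_simps)
qed

text \<open>A weighted maximum again, now with weight \<open>exp (- \<bar>Im k\<bar> * t)\<close>,
  the growth rate of the free solutions. The factor 1/k of the kernel and
  \<open>2 * (P * T) \<le> norm k\<close> limit the integral term to half the maximum.\<close>

lemma sl_sol_asymptotics:
  assumes y: "sl_sol T (\<lambda>x. of_real (p x) - k\<^sup>2) y u"
    and P: "\<And>t. t \<in> {0..T} \<Longrightarrow> \<bar>p t\<bar> \<le> P" and k1: "1 \<le> norm k" and kP: "2 * (P * T) \<le> norm k"
    and x: "x \<in> {0..T}"
  defines "A \<equiv> norm (y 0) + norm (u 0)"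
  shows "norm (y x) \<le> 2 * A * exp (\<bar>Im k\<bar> * x)"
    and "norm (y x - y 0 * cos (k * of_real x)) \<le> A * (1 + 2 * (P * T)) / norm k * exp (\<bar>Im k\<bar> * x)"
    and "norm (u x + y 0 * (k * sin (k * of_real x))) \<le> A * (1 + 2 * (P * T)) * exp (\<bar>Im k\<bar> * x)"
proof -
  define \<tau> where "\<tau> = \<bar>Im k\<bar>"
  have T: "0 \<le> T" using x by auto
  have P0: "0 \<le> P" using order_trans[OF abs_ge_zero P[of 0]] T by auto
  have k0: "k \<noteq> 0" using k1 by auto
  have A0: "A \<ge> 0" by (simp add: A_def)
  have ecos: "norm (cos (k * (of_real s - of_real t))) \<le> exp (\<tau> * (s - t))"
    and esin: "norm (sin (k * (of_real s - of_real t))) \<le> exp (\<tau> * (s - t))" if "t \<le> s" for s t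
    using norm_cos_le_exp_Im[of "k * (of_real s - of_real t)"]
      norm_sin_le_exp_Im[of "k * (of_real s - of_real t)"] that
    by (simp_all add: \<tau>_def abs_mult flip: of_real_diff)
  note ecos0 = ecos[of 0, simplified] and esin0 = esin[of 0, simplified]
  define g where "g t = exp (- \<tau> * t) * norm (y t)" for t
  have "continuous_on {0..T} g"
    unfolding g_def by (intro continuous_intros sl_solD[OF y])
  then obtain s where s: "s \<in> {0..T}" and gs: "\<And>t. t \<in> {0..T} \<Longrightarrow> g t \<le> g s"
    using continuous_attains_sup[of "{0..T}" g] T by auto
  define m where "m = g s"
  have m0: "m \<ge> 0" by (simp add: m_def g_def)
  have bnd: "norm (y t) \<le> m * exp (\<tau> * t)" if "t \<in> {0..T}" for t
  proof -
    have "norm (y t) = g t * exp (\<tau> * t)" by (simp add: g_def exp_minus field_simps)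
    also have "\<dots> \<le> m * exp (\<tau> * t)" using gs[OF that] by (simp add: m_def)
    finally show ?thesis .
  qed
  \<comment> \<open>The growth of the kernel over r - t and that of the solution over t combine to
    \<open>exp (\<tau> * r)\<close>, whatever \<open>t\<close> is.\<close>
  have ker: "norm (K t * (of_real (p t) * y t)) \<le> P * m * exp (\<tau> * r)"
    if r: "r \<in> {0..T}" and t: "t \<in> {0..r}" and K: "norm (K t) \<le> exp (\<tau> * (r - t))" for K r t
  proof -
    have tT: "t \<in> {0..T}" using r t by auto
    have "norm (K t * (of_real (p t) * y t)) \<le> exp (\<tau> * (r - t)) * (P * (m * exp (\<tau> * t)))"
      unfolding norm_mult norm_of_real
      by (intro mult_mono K P tT bnd) (use P0 m0 in auto)
    also have "\<dots> = P * m * (exp (\<tau> * (r - t)) * exp (\<tau> * t))" by (simp add: algebra_simps)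
    also have "exp (\<tau> * (r - t)) * exp (\<tau> * t) = exp (\<tau> * r)"
      by (simp add: algebra_simps flip: exp_add)
    finally show ?thesis .
  qed
  have ci: "((\<lambda>t. c) has_integral (c * r)) {0..r}" if "r \<in> {0..T}" for c r :: real
    using has_integral_const_real[of c 0 r] that by (simp add: mult.commute)
  have cm: "c * r \<le> c * T" if "r \<in> {0..T}" "0 \<le> c" for c r
    using that by (intro mult_left_mono) auto
  have I1: "norm (y r - (y 0 * cos (k * of_real r) + u 0 * (sin (k * of_real r) / k)))
      \<le> P * m * T / norm k * exp (\<tau> * r)" if r: "r \<in> {0..T}" for r
  proof -
    have "norm (y r - (y 0 * cos (k * of_real r) + u 0 * (sin (k * of_real r) / k)))
      \<le> (P * m * exp (\<tau> * r) / norm k) * r"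
    proof (rule norm_has_integral_le[OF sl_sol_volterra(1)[OF y k0 r] ci[OF r]])
      fix t assume t: "t \<in> {0..r}"
      have "norm (sin (k * (of_real r - of_real t)) * (of_real (p t) * y t)) \<le> P * m * exp (\<tau> * r)"
        using ker[OF r t, of "\<lambda>t. sin (k * (of_real r - of_real t))"] esin[of t r] t by auto
      then show "norm (sin (k * (of_real r - of_real t)) / k * (of_real (p t) * y t)) \<le> P * m * exp (\<tau> * r) / norm k"
        by (simp add: norm_mult norm_divide divide_right_mono)
    qed
    also have "\<dots> \<le> (P * m * exp (\<tau> * r) / norm k) * T" by (rule cm[OF r]) (use P0 m0 in auto)
    finally show ?thesis by (simp add: algebra_simps)
  qed
  have I2: "norm (u r - (u 0 * cos (k * of_real r) - y 0 * (k * sin (k * of_real r))))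
      \<le> P * m * T * exp (\<tau> * r)" if r: "r \<in> {0..T}" for r
  proof -
    have "norm (u r - (u 0 * cos (k * of_real r) - y 0 * (k * sin (k * of_real r))))
      \<le> (P * m * exp (\<tau> * r)) * r"
    proof (rule norm_has_integral_le[OF sl_sol_volterra(2)[OF y k0 r] ci[OF r]])
      fix t assume t: "t \<in> {0..r}"
      then show "norm (cos (k * (of_real r - of_real t)) * (of_real (p t) * y t)) \<le> P * m * exp (\<tau> * r)"
        using ker[OF r t, of "\<lambda>t. cos (k * (of_real r - of_real t))"] ecos[of t r] t by auto
    qed
    also have "\<dots> \<le> (P * m * exp (\<tau> * r)) * T" by (rule cm[OF r]) (use P0 m0 in auto)
    finally show ?thesis by (simp add: algebra_simps)
  qed
  have J0: "norm (y 0 * cos (k * of_real r)) \<le> norm (y 0) * exp (\<tau> * r)"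
    and J1: "norm (u 0 * (sin (k * of_real r) / k)) \<le> norm (u 0) / norm k * exp (\<tau> * r)"
    and J2: "norm (u 0 * cos (k * of_real r)) \<le> norm (u 0) * exp (\<tau> * r)" if r: "r \<in> {0..T}" for r
    using ecos0[of r] esin0[of r] r k0
    by (auto simp: norm_mult norm_divide divide_right_mono mult_left_mono)
  have uk: "norm (u 0) / norm k \<le> norm (u 0)" using k1 by (simp add: divide_le_eq mult_left_le mult_le_cancel_left1)
  have PT: "P * m * T / norm k \<le> m / 2"
  proof -
    have "(2 * (P * T)) * m \<le> norm k * m" using kP m0 by (rule mult_right_mono)
    then show ?thesis using k0 by (simp add: field_simps)
  qed
  \<comment> \<open>The estimate at the maximiser \<open>s\<close> leads to
    \<open>m \<le> A + m / 2\<close>; the resulting bound \<open>m \<le> 2 * A\<close> is then fed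
    back into both Volterra formulas.\<close>
  have "norm (y s) \<le> norm (y 0 * cos (k * of_real s)) + norm (u 0 * (sin (k * of_real s) / k))
     + norm (y s - (y 0 * cos (k * of_real s) + u 0 * (sin (k * of_real s) / k)))"
    by (smt (verit) norm_triangle_ineq norm_triangle_sub)
  also have "\<dots> \<le> norm (y 0) * exp (\<tau> * s) + norm (u 0) / norm k * exp (\<tau> * s) + P * m * T / norm k * exp (\<tau> * s)"
    by (intro add_mono J0 J1 I1 s)
  also have "\<dots> = (norm (y 0) + norm (u 0) / norm k + P * m * T / norm k) * exp (\<tau> * s)"
    by (simp add: algebra_simps)
  also have "\<dots> \<le> (A + m / 2) * exp (\<tau> * s)"
    using uk PT unfolding A_def by (intro mult_right_mono add_mono order_refl) auto
  finally have ys: "norm (y s) \<le> (A + m / 2) * exp (\<tau> * s)" .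
  have "m = exp (- \<tau> * s) * norm (y s)" by (simp add: m_def g_def)
  also have "\<dots> \<le> exp (- \<tau> * s) * ((A + m / 2) * exp (\<tau> * s))"
    using ys by (rule mult_left_mono) simp
  also have "\<dots> = A + m / 2" by (simp add: exp_minus field_simps)
  finally have "m \<le> A + m / 2" .
  then have m2: "m \<le> 2 * A" by simp
  have "norm (y x) \<le> m * exp (\<tau> * x)" by (rule bnd[OF x])
  also have "\<dots> \<le> 2 * A * exp (\<tau> * x)" using m2 by (intro mult_right_mono) auto
  finally show "norm (y x) \<le> 2 * A * exp (\<bar>Im k\<bar> * x)" by (simp add: \<tau>_def)
  have fin: "norm (u 0) + P * m * T \<le> A * (1 + 2 * (P * T))"
  proof -
    have "P * m * T \<le> P * (2 * A) * T" using m2 P0 T m0 A0 by (intro mult_mono) auto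
    moreover have "norm (u 0) \<le> A" by (simp add: A_def)
    ultimately show ?thesis by (simp add: algebra_simps)
  qed
  have "norm (y x - y 0 * cos (k * of_real x)) \<le> norm (u 0 * (sin (k * of_real x) / k))
     + norm (y x - (y 0 * cos (k * of_real x) + u 0 * (sin (k * of_real x) / k)))"
    using norm_triangle_ineq[of "u 0 * (sin (k * of_real x) / k)"
        "y x - (y 0 * cos (k * of_real x) + u 0 * (sin (k * of_real x) / k))"]
    by (simp add: algebra_simps)
  also have "\<dots> \<le> norm (u 0) / norm k * exp (\<tau> * x) + P * m * T / norm k * exp (\<tau> * x)"
    by (intro add_mono J1 I1 x)
  also have "\<dots> = (norm (u 0) + P * m * T) / norm k * exp (\<tau> * x)"
    by (simp add: add_divide_distrib algebra_simps)
  also have "\<dots> \<le> A * (1 + 2 * (P * T)) / norm k * exp (\<tau> * x)"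
    using fin by (intro mult_right_mono divide_right_mono) auto
  finally show "norm (y x - y 0 * cos (k * of_real x)) \<le> A * (1 + 2 * (P * T)) / norm k * exp (\<bar>Im k\<bar> * x)"
    by (simp add: \<tau>_def)
  have "norm (u x + y 0 * (k * sin (k * of_real x))) \<le> norm (u 0 * cos (k * of_real x))
     + norm (u x - (u 0 * cos (k * of_real x) - y 0 * (k * sin (k * of_real x))))"
    using norm_triangle_ineq[of "u 0 * cos (k * of_real x)"
        "u x - (u 0 * cos (k * of_real x) - y 0 * (k * sin (k * of_real x)))"]
    by (simp add: algebra_simps)
  also have "\<dots> \<le> norm (u 0) * exp (\<tau> * x) + P * m * T * exp (\<tau> * x)"
    by (intro add_mono J2 I2 x)
  also have "\<dots> = (norm (u 0) + P * m * T) * exp (\<tau> * x)"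
    by (simp add: algebra_simps)
  also have "\<dots> \<le> A * (1 + 2 * (P * T)) * exp (\<tau> * x)"
    using fin by (intro mult_right_mono) auto
  finally show "norm (u x + y 0 * (k * sin (k * of_real x))) \<le> A * (1 + 2 * (P * T)) * exp (\<bar>Im k\<bar> * x)"
    by (simp add: \<tau>_def)
qed

text \<open>Since the initial data are fixed, one constant \<open>C\<close> can serve both as the
  threshold for |k| and as the factor in all three estimates.\<close>

lemma sl_family_asymptotics:
  assumes T: "0 < T" and p: "continuous_on {0..T} p" and Y: "sl_family T p a b Y U"
  obtains C where "C \<ge> 1"
    "\<And>k x. C \<le> norm k \<Longrightarrow> x \<in> {0..T} \<Longrightarrow> norm (Y (k\<^sup>2) x) \<le> C * exp (\<bar>Im k\<bar> * x)"
    "\<And>k x. C \<le> norm k \<Longrightarrow> x \<in> {0..T} \<Longrightarrow>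
        norm (Y (k\<^sup>2) x - a * cos (k * of_real x)) \<le> C / norm k * exp (\<bar>Im k\<bar> * x)"
    "\<And>k x. C \<le> norm k \<Longrightarrow> x \<in> {0..T} \<Longrightarrow>
        norm (U (k\<^sup>2) x + a * (k * sin (k * of_real x))) \<le> C * exp (\<bar>Im k\<bar> * x)"
proof -
  obtain P where P0: "P > 0" and P: "\<And>t. t \<in> {0..T} \<Longrightarrow> \<bar>p t\<bar> \<le> P"
    using continuous_on_Icc_bound[OF p] by (metis real_norm_def)
  define A where "A = norm a + norm b"
  define C where "C = max 1 (max (2 * (P * T)) (max (2 * A) (A * (1 + 2 * (P * T)))))"
  have C: "1 \<le> C" "2 * (P * T) \<le> C" "2 * A \<le> C" "A * (1 + 2 * (P * T)) \<le> C" by (auto simp: C_def)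
  note as = sl_sol_asymptotics[OF sl_familyD(1)[OF Y] P, unfolded sl_familyD(2,3)[OF Y], folded A_def]
  show ?thesis
  proof (rule that[OF C(1)])
    fix k :: complex and x assume k: "C \<le> norm k" and x: "x \<in> {0..T}"
    have k': "1 \<le> norm k" "2 * (P * T) \<le> norm k" using k C by auto
    show "norm (Y (k\<^sup>2) x) \<le> C * exp (\<bar>Im k\<bar> * x)"
      by (rule order_trans[OF as(1)[OF _ k' x]]) (use C in \<open>auto intro!: mult_right_mono\<close>)
    show "norm (Y (k\<^sup>2) x - a * cos (k * of_real x)) \<le> C / norm k * exp (\<bar>Im k\<bar> * x)"
      by (rule order_trans[OF as(2)[OF _ k' x]]) (use C in \<open>auto intro!: mult_right_mono divide_right_mono\<close>)
    show "norm (U (k\<^sup>2) x + a * (k * sin (k * of_real x))) \<le> C * exp (\<bar>Im k\<bar> * x)"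
      by (rule order_trans[OF as(3)[OF _ k' x]]) (use C in \<open>auto intro!: mult_right_mono\<close>)
  qed
qed

section \<open>Entire functions decaying on squares\<close>

text \<open>The boundary curve of the square about 0 with half side \<open>r\<close>, on which the
  maximum principle is used.\<close>

definition on_square :: "real \<Rightarrow> complex \<Rightarrow> bool" where
  "on_square r k \<longleftrightarrow> \<bar>Re k\<bar> \<le> r \<and> \<bar>Im k\<bar> \<le> r \<and> (\<bar>Re k\<bar> = r \<or> \<bar>Im k\<bar> = r)"

lemma on_square_norm_ge: "on_square r k \<Longrightarrow> r \<le> norm k"
  unfolding on_square_def using abs_Re_le_cmod[of k] abs_Im_le_cmod[of k] by auto

text \<open>By the maximum modulus principle |f z| is at most |C| / r n for all large n, and this
  tends to 0.\<close>

lemma entire_eq_0_of_decay_on_squares: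
  assumes f: "f holomorphic_on UNIV" and r: "filterlim r at_top sequentially"
    and le: "\<And>n k. on_square (r n) k \<Longrightarrow> R \<le> norm k \<Longrightarrow> norm (f k) \<le> C / norm k"
  shows "f z = 0"
proof -
  have ev: "\<forall>\<^sub>F n in sequentially. norm (f z) \<le> \<bar>C\<bar> / r n"
    \<comment> \<open>This threshold puts \<open>z\<close> inside the square and its whole boundary
      into the region where the estimate holds.\<close>
    using filterlim_at_top[THEN iffD1, OF r, rule_format, of "max R (norm z + 1)"]
  proof eventually_elim
    case (elim n)
    then have rR: "R \<le> r n" and rz: "norm z < r n" by auto
    then have r0: "r n > 0" using norm_ge_zero[of z] by linarith
    let ?S = "cbox (Complex (- r n) (- r n)) (Complex (r n) (r n))"
    show ?case
    proof (rule maximum_modulus_frontier[of f ?S])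
      show "f holomorphic_on interior ?S" "continuous_on (closure ?S) f"
        using f by (auto intro: holomorphic_on_subset holomorphic_on_imp_continuous_on)
      show "z \<in> ?S"
        using rz abs_Re_le_cmod[of z] abs_Im_le_cmod[of z] by (auto simp: in_cbox_complex_iff)
      fix k assume "k \<in> frontier ?S"
      then have k: "on_square (r n) k"
        by (auto simp: frontier_cbox in_cbox_complex_iff in_box_complex_iff on_square_def)
      have "norm (f k) \<le> C / norm k"
        using le[OF k] on_square_norm_ge[OF k] rR by auto
      also have "\<dots> \<le> \<bar>C\<bar> / r n"
        using on_square_norm_ge[OF k] r0 by (intro frac_le) auto
      finally show "norm (f k) \<le> \<bar>C\<bar> / r n" .
    qed auto
  qed
  have "((\<lambda>n. \<bar>C\<bar> / r n) \<longlongrightarrow> 0) sequentially"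
    by (rule tendsto_divide_0[OF tendsto_const]) (rule filterlim_at_top_imp_at_infinity[OF r])
  then have "norm (f z) \<le> 0"
    using ev by (intro tendsto_lowerbound) auto
  then show ?thesis by simp
qed

text \<open>All zeros of \<open>g\<close> are simple and are zeros of \<open>f\<close>, so the
  singularities of the quotient are removable, the missing values being given by l'Hopital's
  rule.\<close>

lemma entire_quotient:
  assumes f: "f holomorphic_on UNIV" and g: "g holomorphic_on UNIV"
    and zero: "\<And>z. g z = 0 \<Longrightarrow> f z = 0 \<and> deriv g z \<noteq> 0"
  obtains F where "F holomorphic_on UNIV" "\<And>z. f z = F z * g z"
proof -
  define F where "F z = (if g z = 0 then deriv f z / deriv g z else f z / g z)" for z
  have df: "(f has_field_derivative deriv f z) (at z)" and dg: "(g has_field_derivative deriv g z) (at z)" for z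
    using f g by (auto intro!: holomorphic_derivI[of _ UNIV])
  have away: "F field_differentiable at z" if "g z \<noteq> 0" for z
  proof -
    have "(\<lambda>w. f w / g w) field_differentiable at z"
      using df dg that by (intro field_differentiable_divide) (auto simp: field_differentiable_def)
    moreover have "(g \<longlongrightarrow> g z) (nhds z)"
      using DERIV_isCont[OF dg[of z]] by (simp add: isCont_def tendsto_at_iff_tendsto_nhds)
    then have "\<forall>\<^sub>F w in nhds z. g w \<noteq> 0"
      using that by (rule tendsto_imp_eventually_ne)
    then have ev: "\<forall>\<^sub>F w in nhds z. F w = f w / g w"
      by eventually_elim (simp add: F_def)
    ultimately show ?thesis
      unfolding field_differentiable_def DERIV_cong_ev[OF refl ev refl] by simp
  qed
  have "F field_differentiable at z" for z
  proof (cases "g z = 0")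
    case True
    have "((\<lambda>w. (g w - g z) / (w - z)) \<longlongrightarrow> deriv g z) (at z)"
      using dg[of z] by (simp add: has_field_derivative_iff)
    then have "\<forall>\<^sub>F w in at z. (g w - g z) / (w - z) \<noteq> 0"
      using zero[OF True] by (intro tendsto_imp_eventually_ne) auto
    \<comment> \<open>A nonzero derivative isolates the zero of \<open>g\<close>, so the quotient is
      holomorphic on a punctured disc.\<close>
    then have ev: "\<forall>\<^sub>F w in at z. g w \<noteq> 0"
      by eventually_elim (use True in auto)
    have lim: "(F \<longlongrightarrow> F z) (at z)"
    proof (rule Lim_transform_eventually)
      show "((\<lambda>w. f w / g w) \<longlongrightarrow> F z) (at z)"
        by (rule lhopital_complex_simple[OF df dg]) (use zero[OF True] True in \<open>auto simp: F_def\<close>)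
      show "\<forall>\<^sub>F w in at z. f w / g w = F w"
        using ev by eventually_elim (simp add: F_def)
    qed
    from ev
    obtain d where d: "d > 0" "\<And>w. w \<noteq> z \<Longrightarrow> dist w z < d \<Longrightarrow> g w \<noteq> 0"
      by (auto simp: eventually_at)
    have "F holomorphic_on ball z d"
    proof (rule no_isolated_singularity'[where K = "{z}"])
      show "F holomorphic_on ball z d - {z}"
        unfolding holomorphic_on_def
      proof
        fix w assume "w \<in> ball z d - {z}"
        then have "g w \<noteq> 0" using d(2)[of w] by (simp add: dist_commute)
        then show "F field_differentiable at w within ball z d - {z}"
          by (rule field_differentiable_at_within[OF away])
      qed
      show "(F \<longlongrightarrow> F w) (at w within ball z d)" if "w \<in> {z}" for w
        using tendsto_within_subset[OF lim] that by simp
    qed auto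
    then show ?thesis
      by (rule holomorphic_on_imp_differentiable_at) (use d in auto)
  qed (rule away)
  then have "F holomorphic_on UNIV" by (auto simp: holomorphic_on_def)
  moreover have "f z = F z * g z" for z using zero[of z] by (auto simp: F_def)
  ultimately show ?thesis using that by blast
qed

section \<open>Functions of the spectral parameter estimated in the k-plane\<close>

lemma holomorphic_on_compose_square:
  assumes "f holomorphic_on UNIV"
  shows "(\<lambda>k. f (k\<^sup>2)) holomorphic_on UNIV"
proof -
  have sq: "(\<lambda>k::complex. k\<^sup>2) holomorphic_on UNIV" by (intro holomorphic_intros)
  show ?thesis
    using holomorphic_on_compose_gen[OF sq assms] by (simp add: o_def)
qed

text \<open>The quotient \<open>F\<close> of \<open>f\<close> by \<open>g\<close> is entire and
  \<open>F (k\<^sup>2)\<close> decays on the squares, hence is 0; every complex number is a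
  square.\<close>

lemma entire_eq_0_of_quotient_decay:
  assumes f: "f holomorphic_on UNIV" and g: "g holomorphic_on UNIV"
    and zero: "\<And>z. g z = 0 \<Longrightarrow> f z = 0 \<and> deriv g z \<noteq> 0"
    and r: "filterlim r at_top sequentially"
    and le: "\<And>n k. on_square (r n) k \<Longrightarrow> R \<le> norm k \<Longrightarrow>
        g (k\<^sup>2) \<noteq> 0 \<and> norm (f (k\<^sup>2)) \<le> C / norm k * norm (g (k\<^sup>2))"
  shows "f z = 0"
proof -
  obtain F where F: "F holomorphic_on UNIV" and fF: "\<And>z. f z = F z * g z"
    using entire_quotient[OF f g zero] by blast
  have "F (w\<^sup>2) = 0" for w
  proof (rule entire_eq_0_of_decay_on_squares[where f = "\<lambda>k. F (k\<^sup>2)", OF _ r])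
    show "(\<lambda>k. F (k\<^sup>2)) holomorphic_on UNIV"
      using F by (rule holomorphic_on_compose_square)
    fix n k assume k: "on_square (r n) k" "R \<le> norm k"
    show "norm (F (k\<^sup>2)) \<le> C / norm k"
    proof -
      have "norm (F (k\<^sup>2)) * norm (g (k\<^sup>2)) \<le> C / norm k * norm (g (k\<^sup>2))" "norm (g (k\<^sup>2)) > 0"
        using le[OF k] unfolding fF norm_mult by auto
      then show ?thesis by (rule mult_right_le_imp_le)
    qed
  qed
  from this[of "csqrt z"] show ?thesis by (simp add: fF)
qed

text \<open>On the vertical sides Re (k T) is a multiple of pi, where the real cosine is 1 or -1; on
  the horizontal sides \<open>k1\<close> gives |Im (k T)| \<ge> 1.\<close>

lemma norm_cos_ge_on_square:
  assumes T: "0 < T" and k: "on_square (real n * pi / T) k" and k1: "1 / T \<le> real n * pi / T"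
  shows "exp (\<bar>Im k\<bar> * T) / 4 \<le> norm (cos (k * of_real T))"
proof -
  have "\<bar>cos (Re (k * of_real T))\<bar> = 1 \<or> 1 \<le> \<bar>Im (k * of_real T)\<bar>"
  proof (cases "\<bar>Re k\<bar> = real n * pi / T")
    case True
    then have "\<bar>Re (k * of_real T)\<bar> = real n * pi" using T by (simp add: abs_mult)
    then have "cos (Re (k * of_real T)) = cos (real n * pi)" by (metis cos_abs_real)
    then show ?thesis by (simp add: cos_npi)
  next
    case False
    then have "\<bar>Im k\<bar> = real n * pi / T" using k by (auto simp: on_square_def)
    then show ?thesis using T k1 by (simp add: abs_mult field_simps)
  qed
  from norm_cos_ge_exp_Im[OF this] show ?thesis using T by (simp add: abs_mult)
qed

text \<open>The shift by 1/2 makes the real sine equal to 1 or -1 on the vertical sides; on the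
  horizontal sides |Im (k T)| is at least pi/2 for every \<open>n\<close>.\<close>

lemma norm_sin_ge_on_square:
  assumes T: "0 < T" and k: "on_square ((real n + 1 / 2) * pi / T) k"
  shows "exp (\<bar>Im k\<bar> * T) / 4 \<le> norm (sin (k * of_real T))"
proof -
  have "\<bar>sin (Re (k * of_real T))\<bar> = 1 \<or> 1 \<le> \<bar>Im (k * of_real T)\<bar>"
  proof (cases "\<bar>Re k\<bar> = (real n + 1 / 2) * pi / T")
    case True
    then have "\<bar>Re (k * of_real T)\<bar> = (real n + 1 / 2) * pi" using T by (simp add: abs_mult)
    then have "Re (k * of_real T) = (real n + 1 / 2) * pi \<or> Re (k * of_real T) = - ((real n + 1 / 2) * pi)"
      by linarith
    then have "\<bar>sin (Re (k * of_real T))\<bar> = \<bar>sin ((real n + 1 / 2) * pi)\<bar>"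
      by (elim disjE; simp only: sin_minus abs_minus_cancel)
    also have "sin ((real n + 1 / 2) * pi) = cos (real n * pi)"
      by (simp add: distrib_right sin_add)
    finally show ?thesis by (simp add: cos_npi)
  next
    case False
    then have "\<bar>Im k\<bar> = (real n + 1 / 2) * pi / T" using k by (auto simp: on_square_def)
    then have "\<bar>Im k\<bar> * T = real n * pi + pi / 2" using T by (simp add: field_simps)
    moreover have "pi / 2 \<ge> 1" using pi_ge_two by simp
    moreover have "real n * pi \<ge> 0" by simp
    ultimately have "\<bar>Im k\<bar> * T \<ge> 1" by linarith
    then show ?thesis using T by (simp add: abs_mult)
  qed
  from norm_sin_ge_exp_Im[OF this] show ?thesis using T by (simp add: abs_mult)
qed

lemma filterlim_cos_squares: "0 < T \<Longrightarrow> filterlim (\<lambda>n. real n * pi / T) at_top sequentially"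
  and filterlim_sin_squares: "0 < T \<Longrightarrow> filterlim (\<lambda>n. (real n + 1 / 2) * pi / T) at_top sequentially"
  by real_asymp+

lemma sl_family_lower_Y:
  assumes T: "0 < T" and p: "continuous_on {0..T} p" and Y: "sl_family T p 1 b Y U"
  obtains R where "R > 0"
    "\<And>n k. on_square (real n * pi / T) k \<Longrightarrow> R \<le> norm k \<Longrightarrow> exp (\<bar>Im k\<bar> * T) / 8 \<le> norm (Y (k\<^sup>2) T)"
proof -
  have TT: "T \<in> {0..T}" using T by auto
  obtain C where C: "C \<ge> 1" and
    C2: "\<And>k x. C \<le> norm k \<Longrightarrow> x \<in> {0..T} \<Longrightarrow>
        norm (Y (k\<^sup>2) x - 1 * cos (k * of_real x)) \<le> C / norm k * exp (\<bar>Im k\<bar> * x)"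
    using sl_family_asymptotics[OF T p Y] by metis
  \<comment> \<open>\<open>8 * C\<close> lowers the error to half of the bound
    \<open>exp (\<bar>Im k\<bar> * T) / 4\<close> for the cosine. As |k| is at most twice the half
    side, \<open>2 / T\<close> makes the half side at least \<open>1 / T\<close>.\<close>
  define R where "R = max (8 * C) (2 / T)"
  have "exp (\<bar>Im k\<bar> * T) / 8 \<le> norm (Y (k\<^sup>2) T)"
    if k: "on_square (real n * pi / T) k" and kR: "R \<le> norm k" for n k
  proof -
    have "norm k \<le> \<bar>Re k\<bar> + \<bar>Im k\<bar>" by (rule cmod_le)
    then have "norm k \<le> 2 * (real n * pi / T)" using k by (auto simp: on_square_def)
    then have n1: "1 / T \<le> real n * pi / T" using kR by (auto simp: R_def)
    have k8: "8 * C \<le> norm k" using kR by (simp add: R_def)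
    then have "C / norm k \<le> 1 / 8" using C by (subst pos_divide_le_eq) auto
    then have "C / norm k * exp (\<bar>Im k\<bar> * T) \<le> 1 / 8 * exp (\<bar>Im k\<bar> * T)"
      by (rule mult_right_mono) auto
    moreover have "norm (Y (k\<^sup>2) T - cos (k * of_real T)) \<le> C / norm k * exp (\<bar>Im k\<bar> * T)"
      using C2[OF _ TT, of k] k8 C by simp
    moreover have "norm (cos (k * of_real T)) \<le> norm (Y (k\<^sup>2) T) + norm (Y (k\<^sup>2) T - cos (k * of_real T))"
      using norm_triangle_sub[of "cos (k * of_real T)" "Y (k\<^sup>2) T"] by (simp add: norm_minus_commute)
    ultimately show ?thesis using norm_cos_ge_on_square[OF T k n1] by linarith
  qed
  moreover have "R > 0" using C by (simp add: R_def)
  ultimately show ?thesis using that by blast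
qed

text \<open>The term k sin (k T) dominates: the remainder of \<open>U\<close> and the term with
  \<open>h\<close> lack the factor k and take at most half of its lower bound once |k| is
  large.\<close>

lemma sl_family_lower_U:
  assumes T: "0 < T" and p: "continuous_on {0..T} p" and Y: "sl_family T p 1 b Y U"
  obtains R where "R > 0"
    "\<And>n k. on_square ((real n + 1 / 2) * pi / T) k \<Longrightarrow> R \<le> norm k \<Longrightarrow>
       norm k * exp (\<bar>Im k\<bar> * T) / 8 \<le> norm (h * Y (k\<^sup>2) T + U (k\<^sup>2) T)"
proof -
  have TT: "T \<in> {0..T}" using T by auto
  obtain C where C: "C \<ge> 1" and
    C1: "\<And>k x. C \<le> norm k \<Longrightarrow> x \<in> {0..T} \<Longrightarrow> norm (Y (k\<^sup>2) x) \<le> C * exp (\<bar>Im k\<bar> * x)" and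
    C3: "\<And>k x. C \<le> norm k \<Longrightarrow> x \<in> {0..T} \<Longrightarrow>
        norm (U (k\<^sup>2) x + 1 * (k * sin (k * of_real x))) \<le> C * exp (\<bar>Im k\<bar> * x)"
    using sl_family_asymptotics[OF T p Y] by metis
  define R where "R = 8 * (C + norm h * C)"
  have RC: "C \<le> R" using C by (simp add: R_def)
  have "norm k * exp (\<bar>Im k\<bar> * T) / 8 \<le> norm (h * Y (k\<^sup>2) T + U (k\<^sup>2) T)"
    if k: "on_square ((real n + 1 / 2) * pi / T) k" and kR: "R \<le> norm k" for n k
  proof -
    define e where "e = exp (\<bar>Im k\<bar> * T)"
    have kC: "C \<le> norm k" using kR RC by simp
    have "(C + norm h * C) * e \<le> norm k / 8 * e"
      using kR by (intro mult_right_mono) (auto simp: R_def e_def)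
    moreover have "norm (h * Y (k\<^sup>2) T) \<le> norm h * (C * e)"
      unfolding norm_mult e_def by (intro mult_left_mono C1 kC TT) auto
    moreover have "norm (U (k\<^sup>2) T + k * sin (k * of_real T)) \<le> C * e"
      using C3[OF kC TT] by (simp add: e_def)
    moreover have "norm k * (e / 4) \<le> norm (k * sin (k * of_real T))"
      unfolding norm_mult e_def by (intro mult_left_mono norm_sin_ge_on_square[OF T k]) auto
    moreover have "norm (k * sin (k * of_real T)) \<le> norm (U (k\<^sup>2) T + k * sin (k * of_real T))
        + norm (h * Y (k\<^sup>2) T) + norm (h * Y (k\<^sup>2) T + U (k\<^sup>2) T)"
      using norm_triangle_ineq4[of "(U (k\<^sup>2) T + k * sin (k * of_real T)) + h * Y (k\<^sup>2) T"
          "h * Y (k\<^sup>2) T + U (k\<^sup>2) T"]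
        norm_triangle_ineq[of "U (k\<^sup>2) T + k * sin (k * of_real T)" "h * Y (k\<^sup>2) T"] by simp
    ultimately have "norm k * e / 8 \<le> norm (h * Y (k\<^sup>2) T + U (k\<^sup>2) T)" by (simp add: algebra_simps)
    then show ?thesis by (simp add: e_def)
  qed
  moreover have "R > 0" using RC C by simp
  ultimately show ?thesis using that by blast
qed

section \<open>Uniqueness from two spectra\<close>

text \<open>Both functions have the same leading term cos (k T), so their difference divided by
  \<open>Y l T\<close> is O(1/|k|) on the squares; the quotient is entire because the zeros agree
  and, being real, are simple.\<close>

lemma sl_family_dirichlet_char_unique:
  assumes T: "0 < T" and p: "continuous_on {0..T} p" and p': "continuous_on {0..T} p'"
    and Y: "sl_family T p 1 (of_real b) Y U" and Y': "sl_family T p' 1 (of_real b') Y' U'"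
    and eq: "\<And>l. Y l T = 0 \<longleftrightarrow> Y' l T = 0" and real: "\<And>l. Y l T = 0 \<Longrightarrow> l \<in> \<real>"
  shows "Y l T = Y' l T"
proof -
  have TT: "T \<in> {0..T}" using T by auto
  obtain C where C: "C \<ge> 1" and
    C2: "\<And>k x. C \<le> norm k \<Longrightarrow> x \<in> {0..T} \<Longrightarrow>
        norm (Y (k\<^sup>2) x - 1 * cos (k * of_real x)) \<le> C / norm k * exp (\<bar>Im k\<bar> * x)"
    using sl_family_asymptotics[OF T p Y] by metis
  obtain C' where C': "C' \<ge> 1" and
    C2': "\<And>k x. C' \<le> norm k \<Longrightarrow> x \<in> {0..T} \<Longrightarrow>
        norm (Y' (k\<^sup>2) x - 1 * cos (k * of_real x)) \<le> C' / norm k * exp (\<bar>Im k\<bar> * x)"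
    using sl_family_asymptotics[OF T p' Y'] by metis
  obtain R where R: "R > 0" and
    low: "\<And>n k. on_square (real n * pi / T) k \<Longrightarrow> R \<le> norm k \<Longrightarrow> exp (\<bar>Im k\<bar> * T) / 8 \<le> norm (Y (k\<^sup>2) T)"
    using sl_family_lower_Y[OF T p Y] by metis
  have "Y' l T - Y l T = 0"
  proof (rule entire_eq_0_of_quotient_decay[where f = "\<lambda>l. Y' l T - Y l T" and g = "\<lambda>l. Y l T"
        and R = "max R (max C C')" and C = "8 * (C + C')", OF _ _ _ filterlim_cos_squares[OF T]])
    show "(\<lambda>l. Y' l T - Y l T) holomorphic_on UNIV"
      by (intro holomorphic_intros sl_family_holomorphic[OF T p Y TT] sl_family_holomorphic[OF T p' Y' TT])
    show "(\<lambda>l. Y l T) holomorphic_on UNIV" by (rule sl_family_holomorphic[OF T p Y TT])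
    show "Y' z T - Y z T = 0 \<and> deriv (\<lambda>l. Y l T) z \<noteq> 0" if z: "Y z T = 0" for z
    proof -
      obtain r where r: "z = of_real r" using real[OF z] by (elim Reals_cases)
      have "deriv (\<lambda>l. 1 * Y l T + 0 * U l T) (of_real r) \<noteq> 0"
        by (rule sl_family_simple_zero[OF T p, of 1]) (use Y z r in auto)
      then show ?thesis using z eq[of z] r by simp
    qed
    fix n k assume k: "on_square (real n * pi / T) k" and kR: "max R (max C C') \<le> norm k"
    define e where "e = exp (\<bar>Im k\<bar> * T)"
    have e0: "e > 0" by (simp add: e_def)
    have k0: "norm k > 0" using kR R by linarith
    have g: "e / 8 \<le> norm (Y (k\<^sup>2) T)" using low[OF k] kR by (simp add: e_def)
    have "Y' (k\<^sup>2) T - Y (k\<^sup>2) T = (Y' (k\<^sup>2) T - 1 * cos (k * of_real T)) - (Y (k\<^sup>2) T - 1 * cos (k * of_real T))"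
      by simp
    also have "norm \<dots> \<le> C' / norm k * e + C / norm k * e"
      unfolding e_def by (intro norm_triangle_le_diff add_mono C2 C2' TT) (use kR in auto)
    also have "\<dots> = 8 * (C + C') / norm k * (e / 8)" by (simp add: field_simps add_divide_distrib)
    also have "\<dots> \<le> 8 * (C + C') / norm k * norm (Y (k\<^sup>2) T)"
      using g C C' by (intro mult_left_mono) auto
    finally show "Y (k\<^sup>2) T \<noteq> 0 \<and> norm (Y' (k\<^sup>2) T - Y (k\<^sup>2) T) \<le> 8 * (C + C') / norm k * norm (Y (k\<^sup>2) T)"
      using g e0 by auto
  qed
  then show ?thesis by simp
qed

text \<open>The common leading term is now - k sin (k T). The difference is only O(exp (T |Im k|)),
  but the divisor is larger by a factor |k|, which again yields decay.\<close>

lemma sl_family_robin_char_unique: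
  assumes T: "0 < T" and p: "continuous_on {0..T} p" and p': "continuous_on {0..T} p'"
    and Y: "sl_family T p 1 (of_real b) Y U" and Y': "sl_family T p' 1 (of_real b') Y' U'"
    and eq: "\<And>l. h * Y l T + U l T = 0 \<longleftrightarrow> h' * Y' l T + U' l T = 0"
    and real: "\<And>l. h * Y l T + U l T = 0 \<Longrightarrow> l \<in> \<real>"
  shows "h * Y l T + U l T = h' * Y' l T + U' l T"
proof -
  have TT: "T \<in> {0..T}" using T by auto
  obtain C where C: "C \<ge> 1" and
    C1: "\<And>k x. C \<le> norm k \<Longrightarrow> x \<in> {0..T} \<Longrightarrow> norm (Y (k\<^sup>2) x) \<le> C * exp (\<bar>Im k\<bar> * x)" and
    C3: "\<And>k x. C \<le> norm k \<Longrightarrow> x \<in> {0..T} \<Longrightarrow>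
        norm (U (k\<^sup>2) x + 1 * (k * sin (k * of_real x))) \<le> C * exp (\<bar>Im k\<bar> * x)"
    using sl_family_asymptotics[OF T p Y] by metis
  obtain C' where C': "C' \<ge> 1" and
    C1': "\<And>k x. C' \<le> norm k \<Longrightarrow> x \<in> {0..T} \<Longrightarrow> norm (Y' (k\<^sup>2) x) \<le> C' * exp (\<bar>Im k\<bar> * x)" and
    C3': "\<And>k x. C' \<le> norm k \<Longrightarrow> x \<in> {0..T} \<Longrightarrow>
        norm (U' (k\<^sup>2) x + 1 * (k * sin (k * of_real x))) \<le> C' * exp (\<bar>Im k\<bar> * x)"
    using sl_family_asymptotics[OF T p' Y'] by metis
  obtain R where R: "R > 0" and
    low: "\<And>n k. on_square ((real n + 1 / 2) * pi / T) k \<Longrightarrow> R \<le> norm k \<Longrightarrow>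
       norm k * exp (\<bar>Im k\<bar> * T) / 8 \<le> norm (h * Y (k\<^sup>2) T + U (k\<^sup>2) T)"
    using sl_family_lower_U[OF T p Y] by metis
  define D where "D = norm h' * C' + norm h * C + C' + C"
  have D0: "D \<ge> 0" using C C' by (simp add: D_def)
  have "(h' * Y' l T + U' l T) - (h * Y l T + U l T) = 0"
  proof (rule entire_eq_0_of_quotient_decay[where f = "\<lambda>l. (h' * Y' l T + U' l T) - (h * Y l T + U l T)"
        and g = "\<lambda>l. h * Y l T + U l T"
        and R = "max R (max C C')" and C = "8 * D", OF _ _ _ filterlim_sin_squares[OF T]])
    show "(\<lambda>l. (h' * Y' l T + U' l T) - (h * Y l T + U l T)) holomorphic_on UNIV"
      by (intro holomorphic_intros sl_family_holomorphic[OF T p Y TT] sl_family_holomorphic[OF T p' Y' TT])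
    show "(\<lambda>l. h * Y l T + U l T) holomorphic_on UNIV"
      by (intro holomorphic_intros sl_family_holomorphic[OF T p Y TT])
    show "(h' * Y' z T + U' z T) - (h * Y z T + U z T) = 0 \<and> deriv (\<lambda>l. h * Y l T + U l T) z \<noteq> 0"
      if z: "h * Y z T + U z T = 0" for z
    proof -
      obtain r where r: "z = of_real r" using real[OF z] by (elim Reals_cases)
      have "deriv (\<lambda>l. h * Y l T + 1 * U l T) (of_real r) \<noteq> 0"
        by (rule sl_family_simple_zero[OF T p, of 1]) (use Y z r in auto)
      then show ?thesis using z eq[of z] r by simp
    qed
    fix n k assume k: "on_square ((real n + 1 / 2) * pi / T) k" and kR: "max R (max C C') \<le> norm k"
    define e where "e = exp (\<bar>Im k\<bar> * T)"
    have e0: "e > 0" by (simp add: e_def)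
    have k0: "norm k > 0" using kR R by linarith
    have kC: "C \<le> norm k" "C' \<le> norm k" "R \<le> norm k" using kR by auto
    have g: "norm k * e / 8 \<le> norm (h * Y (k\<^sup>2) T + U (k\<^sup>2) T)" using low[OF k kC(3)] by (simp add: e_def)
    let ?s = "1 * (k * sin (k * of_real T))"
    have "(h' * Y' (k\<^sup>2) T + U' (k\<^sup>2) T) - (h * Y (k\<^sup>2) T + U (k\<^sup>2) T)
       = ((h' * Y' (k\<^sup>2) T - h * Y (k\<^sup>2) T) + (U' (k\<^sup>2) T + ?s)) - (U (k\<^sup>2) T + ?s)"
      by simp
    also have "norm \<dots> \<le> norm h' * (C' * e) + norm h * (C * e) + C' * e + C * e"
      unfolding e_def
      by (rule norm_triangle_le_diff, rule add_mono, rule norm_triangle_le, rule add_mono,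
          rule norm_triangle_le_diff, unfold norm_mult[of h'] norm_mult[of h],
          intro add_mono mult_left_mono C1 C1' C3 C3' kC TT norm_ge_zero)
        (intro C3 C3' kC TT)+
    also have "\<dots> = 8 * D / norm k * (norm k * e / 8)" using k0 by (simp add: D_def field_simps)
    also have "\<dots> \<le> 8 * D / norm k * norm (h * Y (k\<^sup>2) T + U (k\<^sup>2) T)"
      using g D0 by (intro mult_left_mono) auto
    finally show "h * Y (k\<^sup>2) T + U (k\<^sup>2) T \<noteq> 0 \<and> norm ((h' * Y' (k\<^sup>2) T + U' (k\<^sup>2) T) - (h * Y (k\<^sup>2) T + U (k\<^sup>2) T))
        \<le> 8 * D / norm k * norm (h * Y (k\<^sup>2) T + U (k\<^sup>2) T)"
      using g mult_pos_pos[OF k0 e0] by auto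
  qed
  then show ?thesis by simp
qed

text \<open>Reflection changes the sign of the first derivative and keeps the second; it turns data
  prescribed at \<open>T\<close> into initial data at 0.\<close>

lemma sl_sol_reflect:
  assumes y: "sl_sol T Q y u"
  shows "sl_sol T (\<lambda>x. Q (T - x)) (\<lambda>x. y (T - x)) (\<lambda>x. - u (T - x))"
  unfolding sl_sol_def
proof (intro conjI ballI)
  show "continuous_on {0..T} (\<lambda>x. y (T - x))" "continuous_on {0..T} (\<lambda>x. - u (T - x))"
    by (intro continuous_intros continuous_on_compose2[OF sl_solD(1)[OF y]]
        continuous_on_compose2[OF sl_solD(2)[OF y]]; force)+
  fix x assume "x \<in> {0<..<T}"
  then have x: "T - x \<in> {0<..<T}" by auto
  have r: "((\<lambda>x. T - x) has_vector_derivative - 1) (at x)"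
    by (auto intro!: derivative_eq_intros simp flip: has_real_derivative_iff_has_vector_derivative)
  show "((\<lambda>x. y (T - x)) has_vector_derivative - u (T - x)) (at x)"
    using vector_diff_chain_at[OF r sl_solD(3)[OF y x]] by (simp add: o_def)
  show "((\<lambda>x. - u (T - x)) has_vector_derivative Q (T - x) * y (T - x)) (at x)"
    using has_vector_derivative_minus[OF vector_diff_chain_at[OF r sl_solD(4)[OF y x]]] by (simp add: o_def)
qed

text \<open>\<open>F * S' - S * F'\<close> is entire in \<open>l\<close>. Times the common Robin
  function it is a difference of products whose growth rates T - x and x add up to T; the lower
  bound for that function has the same exponential and an extra |k|.\<close>

lemma sl_two_spectra_cross_product:
  assumes T: "0 < T" and p: "continuous_on {0..T} p" and p': "continuous_on {0..T} p'"
    and Y: "sl_family T (\<lambda>x. p (T - x)) 1 (of_real H) Y U"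
    and Y': "sl_family T (\<lambda>x. p' (T - x)) 1 (of_real H') Y' U'"
    and D: "\<And>l. Y l T = Y' l T" and N: "\<And>l. of_real h * Y l T + U l T = of_real h' * Y' l T + U' l T"
    and F: "sl_family T p 1 (of_real h) F Fd" and F': "sl_family T p' 1 (of_real h') F' Fd'"
    and S: "sl_family T p 0 1 S Sd" and S': "sl_family T p' 0 1 S' Sd'"
    and x: "x \<in> {0..T}"
  shows "S l x * F' l x = F l x * S' l x"
proof -
  have pr: "continuous_on {0..T} (\<lambda>x. p (T - x))"
    by (intro continuous_intros continuous_on_compose2[OF p]; force)
  have pr': "continuous_on {0..T} (\<lambda>x. p' (T - x))"
    by (intro continuous_intros continuous_on_compose2[OF p']; force)
  have xT: "T - x \<in> {0..T}" using x by auto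
  \<comment> \<open>At 0 the reflected solution has value \<open>Y l T\<close> and derivative
    \<open>- U l T\<close>; the coefficients are read off from the data (1, h) of \<open>F\<close>
    and (0, 1) of \<open>S\<close>. The claim is quantified so that it serves both problems.\<close>
  have decomp: "Y l (T - x) = Y l T * F l x + - (of_real h * Y l T + U l T) * S l x"
    if p: "continuous_on {0..T} p" and Y: "sl_family T (\<lambda>x. p (T - x)) 1 (of_real H) Y U"
      and F: "sl_family T p 1 (of_real h) F Fd" and S: "sl_family T p 0 1 S Sd"
    for p H Y U h F Fd S Sd l
  proof (rule sl_sol_unique(1)[OF _ _ _ _ _ x])
    show "sl_sol T (\<lambda>x. of_real (p x) - l) (\<lambda>x. Y l (T - x)) (\<lambda>x. - U l (T - x))"
      using sl_sol_reflect[OF sl_familyD(1)[OF Y, of l]] by simp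
    show "sl_sol T (\<lambda>x. of_real (p x) - l) (\<lambda>x. Y l T * F l x + - (of_real h * Y l T + U l T) * S l x)
       (\<lambda>x. Y l T * Fd l x + - (of_real h * Y l T + U l T) * Sd l x)"
      by (rule sl_sol_lincomb[OF sl_familyD(1)[OF F] sl_familyD(1)[OF S]])
  qed (use p sl_familyD(2,3)[OF F] sl_familyD(2,3)[OF S] in \<open>auto intro!: continuous_intros\<close>)
  \<comment> \<open>Both expansions have the same coefficients by \<open>D\<close> and
    \<open>N\<close>, so the products \<open>F * F'\<close> cancel.\<close>
  have key: "(of_real h * Y l T + U l T) * (F l x * S' l x - S l x * F' l x)
      = Y l (T - x) * F' l x - F l x * Y' l (T - x)" for l
  proof -
    define d where "d = of_real h * Y l T + U l T"
    have "Y l (T - x) = Y l T * F l x - d * S l x" "Y' l (T - x) = Y l T * F' l x - d * S' l x"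
      unfolding d_def using decomp[OF p Y F S, of l] decomp[OF p' Y' F' S', of l, folded N D]
      by (simp_all add: algebra_simps)
    note e = this
    show ?thesis unfolding e d_def[symmetric] by (simp add: algebra_simps)
  qed
  obtain C1 where C1: "C1 \<ge> 1" and
    B1: "\<And>k x. C1 \<le> norm k \<Longrightarrow> x \<in> {0..T} \<Longrightarrow> norm (Y (k\<^sup>2) x) \<le> C1 * exp (\<bar>Im k\<bar> * x)"
    using sl_family_asymptotics[OF T pr Y] by metis
  obtain C2 where C2: "C2 \<ge> 1" and
    B2: "\<And>k x. C2 \<le> norm k \<Longrightarrow> x \<in> {0..T} \<Longrightarrow> norm (Y' (k\<^sup>2) x) \<le> C2 * exp (\<bar>Im k\<bar> * x)"
    using sl_family_asymptotics[OF T pr' Y'] by metis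
  obtain C3 where C3: "C3 \<ge> 1" and
    B3: "\<And>k x. C3 \<le> norm k \<Longrightarrow> x \<in> {0..T} \<Longrightarrow> norm (F (k\<^sup>2) x) \<le> C3 * exp (\<bar>Im k\<bar> * x)"
    using sl_family_asymptotics[OF T p F] by metis
  obtain C4 where C4: "C4 \<ge> 1" and
    B4: "\<And>k x. C4 \<le> norm k \<Longrightarrow> x \<in> {0..T} \<Longrightarrow> norm (F' (k\<^sup>2) x) \<le> C4 * exp (\<bar>Im k\<bar> * x)"
    using sl_family_asymptotics[OF T p' F'] by metis
  obtain R where R: "R > 0" and
    low: "\<And>n k. on_square ((real n + 1 / 2) * pi / T) k \<Longrightarrow> R \<le> norm k \<Longrightarrow>
       norm k * exp (\<bar>Im k\<bar> * T) / 8 \<le> norm (of_real h * Y (k\<^sup>2) T + U (k\<^sup>2) T)"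
    using sl_family_lower_U[OF T pr Y] by metis
  define E where "E l = F l x * S' l x - S l x * F' l x" for l
  have Eh: "E holomorphic_on UNIV"
    unfolding E_def
    by (intro holomorphic_intros sl_family_holomorphic[OF T p F x] sl_family_holomorphic[OF T p' F' x]
       sl_family_holomorphic[OF T p S x] sl_family_holomorphic[OF T p' S' x])
  have "E (w\<^sup>2) = 0" for w
  proof (rule entire_eq_0_of_decay_on_squares[OF _ filterlim_sin_squares[OF T],
        where f = "\<lambda>k. E (k\<^sup>2)" and R = "R + C1 + C2 + C3 + C4" and C = "8 * (C1 * C4 + C3 * C2)"])
    show "(\<lambda>k. E (k\<^sup>2)) holomorphic_on UNIV"
      using Eh by (rule holomorphic_on_compose_square)
    fix n k assume k: "on_square ((real n + 1 / 2) * pi / T) k" and kR: "R + C1 + C2 + C3 + C4 \<le> norm k"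
    have kC: "R \<le> norm k" "C1 \<le> norm k" "C2 \<le> norm k" "C3 \<le> norm k" "C4 \<le> norm k"
      using kR R C1 C2 C3 C4 by linarith+
    have k0: "norm k > 0" using kC R by linarith
    define e where "e = exp (\<bar>Im k\<bar> * T)"
    have e0: "e > 0" by (simp add: e_def)
    have ee: "exp (\<bar>Im k\<bar> * (T - x)) * exp (\<bar>Im k\<bar> * x) = e"
      by (simp add: e_def algebra_simps flip: exp_add)
    have "norm (Y (k\<^sup>2) (T - x) * F' (k\<^sup>2) x) \<le> (C1 * exp (\<bar>Im k\<bar> * (T - x))) * (C4 * exp (\<bar>Im k\<bar> * x))"
      unfolding norm_mult by (intro mult_mono B1 B4 kC x xT) (use C1 in auto)
    also have "\<dots> = C1 * C4 * e" unfolding ee[symmetric] by (simp add: algebra_simps)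
    finally have 1: "norm (Y (k\<^sup>2) (T - x) * F' (k\<^sup>2) x) \<le> C1 * C4 * e" .
    have "norm (F (k\<^sup>2) x * Y' (k\<^sup>2) (T - x)) \<le> (C3 * exp (\<bar>Im k\<bar> * x)) * (C2 * exp (\<bar>Im k\<bar> * (T - x)))"
      unfolding norm_mult by (intro mult_mono B2 B3 kC x xT) (use C3 in auto)
    also have "\<dots> = C3 * C2 * e" unfolding ee[symmetric] by (simp add: algebra_simps)
    finally have 2: "norm (F (k\<^sup>2) x * Y' (k\<^sup>2) (T - x)) \<le> C3 * C2 * e" .
    have "norm k * e / 8 * norm (E (k\<^sup>2)) \<le> norm (of_real h * Y (k\<^sup>2) T + U (k\<^sup>2) T) * norm (E (k\<^sup>2))"
      using low[OF k kC(1)] unfolding e_def by (intro mult_right_mono) auto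
    also have "\<dots> = norm (Y (k\<^sup>2) (T - x) * F' (k\<^sup>2) x - F (k\<^sup>2) x * Y' (k\<^sup>2) (T - x))"
      using key[of "k\<^sup>2"] unfolding E_def norm_mult[symmetric] by simp
    also have "\<dots> \<le> C1 * C4 * e + C3 * C2 * e"
      using 1 2 by (intro order_trans[OF norm_triangle_ineq4]) auto
    finally have "(norm k * norm (E (k\<^sup>2))) * e \<le> (8 * (C1 * C4 + C3 * C2)) * e"
      by (simp add: algebra_simps)
    then have "norm k * norm (E (k\<^sup>2)) \<le> 8 * (C1 * C4 + C3 * C2)"
      using e0 by (rule mult_right_le_imp_le)
    then show "norm (E (k\<^sup>2)) \<le> 8 * (C1 * C4 + C3 * C2) / norm k"
      using k0 by (simp add: pos_le_divide_eq mult.commute)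
  qed
  from this[of "csqrt l"] show ?thesis by (simp add: E_def)
qed

text \<open>For k = i r with r large both solutions are close to cosh (r x) relative to its size,
  uniformly in x, so neither \<open>F\<close> nor the sum can vanish.\<close>

lemma sl_family_nonzero_at_imaginary:
  assumes T: "0 < T" and p: "continuous_on {0..T} p" and p': "continuous_on {0..T} p'"
    and F: "sl_family T p 1 b F Fd" and F': "sl_family T p' 1 b' F' Fd'"
  obtains l where "\<And>x. x \<in> {0..T} \<Longrightarrow> F l x \<noteq> 0" "\<And>x. x \<in> {0..T} \<Longrightarrow> F l x + F' l x \<noteq> 0"
proof -
  obtain C where C: "C \<ge> 1" and
    A: "\<And>k x. C \<le> norm k \<Longrightarrow> x \<in> {0..T} \<Longrightarrow>
        norm (F (k\<^sup>2) x - 1 * cos (k * of_real x)) \<le> C / norm k * exp (\<bar>Im k\<bar> * x)"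
    using sl_family_asymptotics[OF T p F] by metis
  obtain C' where C': "C' \<ge> 1" and
    A': "\<And>k x. C' \<le> norm k \<Longrightarrow> x \<in> {0..T} \<Longrightarrow>
        norm (F' (k\<^sup>2) x - 1 * cos (k * of_real x)) \<le> C' / norm k * exp (\<bar>Im k\<bar> * x)"
    using sl_family_asymptotics[OF T p' F'] by metis
  \<comment> \<open>With the factor 8 each error is at most \<open>e / 8\<close>, while the cosine
    has modulus at least \<open>e / 4\<close>.\<close>
  define r where "r = 8 * (C + C')"
  define k where "k = \<i> * of_real r"
  have r0: "r > 0" using C C' by (simp add: r_def)
  have nk: "norm k = r" "\<bar>Im k\<bar> = r" using r0 by (auto simp: k_def norm_mult)
  have Cr: "C / r \<le> 1 / 8" "C' / r \<le> 1 / 8" "C \<le> r" "C' \<le> r"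
    using r0 C C' by (auto simp: divide_le_eq r_def)
  have main: "F (k\<^sup>2) x \<noteq> 0 \<and> F (k\<^sup>2) x + F' (k\<^sup>2) x \<noteq> 0" if x: "x \<in> {0..T}" for x
  proof -
    define e where "e = exp (r * x)"
    have e0: "e > 0" by (simp add: e_def)
    define c where "c = cos (k * of_real x)"
    have c: "e / 4 \<le> norm c"
      using norm_cos_ge_exp_Im[of "k * of_real x"] x r0 by (simp add: k_def c_def e_def abs_mult)
    have 1: "norm (F (k\<^sup>2) x - c) \<le> e / 8"
    proof -
      have "norm (F (k\<^sup>2) x - c) \<le> C / r * e" using A[of k, OF _ x] Cr nk by (simp add: c_def e_def)
      also have "\<dots> \<le> 1 / 8 * e" using Cr e0 by (intro mult_right_mono) auto
      finally show ?thesis by simp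
    qed
    have 2: "norm (F' (k\<^sup>2) x - c) \<le> e / 8"
    proof -
      have "norm (F' (k\<^sup>2) x - c) \<le> C' / r * e" using A'[of k, OF _ x] Cr nk by (simp add: c_def e_def)
      also have "\<dots> \<le> 1 / 8 * e" using Cr e0 by (intro mult_right_mono) auto
      finally show ?thesis by simp
    qed
    have "F (k\<^sup>2) x \<noteq> 0" using 1 c e0 by auto
    moreover have "F (k\<^sup>2) x + F' (k\<^sup>2) x \<noteq> 0"
    proof
      assume "F (k\<^sup>2) x + F' (k\<^sup>2) x = 0"
      then have "- (2 * c) = (F (k\<^sup>2) x - c) + (F' (k\<^sup>2) x - c)" by (simp add: algebra_simps)
      then have "norm (- (2 * c)) \<le> e / 8 + e / 8"
        by (simp only:) (intro norm_triangle_le add_mono 1 2)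
      then show False using c e0 by (simp add: norm_mult)
    qed
    ultimately show ?thesis ..
  qed
  show ?thesis by (rule that[of "k\<^sup>2"]) (use main in auto)
qed

theorem sl_two_spectra:
  assumes T: "0 < T" and p: "continuous_on {0..T} p" and p': "continuous_on {0..T} p'"
    and Y: "sl_family T (\<lambda>x. p (T - x)) 1 (of_real H) Y U"
    and Y': "sl_family T (\<lambda>x. p' (T - x)) 1 (of_real H') Y' U'"
    and zD: "\<And>l. Y l T = 0 \<longleftrightarrow> Y' l T = 0" and rD: "\<And>l. Y l T = 0 \<Longrightarrow> l \<in> \<real>"
    and zN: "\<And>l. of_real h * Y l T + U l T = 0 \<longleftrightarrow> of_real h' * Y' l T + U' l T = 0"
    and rN: "\<And>l. of_real h * Y l T + U l T = 0 \<Longrightarrow> l \<in> \<real>"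
  shows "\<And>x. x \<in> {0<..<T} \<Longrightarrow> p x = p' x" "h = h'" "H = H'"
proof -
  have pr: "continuous_on {0..T} (\<lambda>x. p (T - x))"
    by (intro continuous_intros continuous_on_compose2[OF p]; force)
  have pr': "continuous_on {0..T} (\<lambda>x. p' (T - x))"
    by (intro continuous_intros continuous_on_compose2[OF p']; force)
  have D: "Y l T = Y' l T" for l
    by (rule sl_family_dirichlet_char_unique[OF T pr pr' Y Y' zD rD])
  have N: "of_real h * Y l T + U l T = of_real h' * Y' l T + U' l T" for l
    by (rule sl_family_robin_char_unique[OF T pr pr' Y Y' zN rN])
  obtain F Fd where F: "sl_family T p 1 (of_real h) F Fd" using sl_family_exists[OF T p] by blast
  obtain F' Fd' where F': "sl_family T p' 1 (of_real h') F' Fd'" using sl_family_exists[OF T p'] by blast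
  obtain S Sd where S: "sl_family T p 0 1 S Sd" using sl_family_exists[OF T p] by blast
  obtain S' Sd' where S': "sl_family T p' 0 1 S' Sd'" using sl_family_exists[OF T p'] by blast
  obtain l where nz: "\<And>x. x \<in> {0..T} \<Longrightarrow> F l x \<noteq> 0" "\<And>x. x \<in> {0..T} \<Longrightarrow> F l x + F' l x \<noteq> 0"
    using sl_family_nonzero_at_imaginary[OF T p p' F F'] by metis
  note f = sl_familyD[OF F, of l] and f' = sl_familyD[OF F', of l]
    and s = sl_familyD[OF S, of l] and s' = sl_familyD[OF S', of l]
  have cross: "S l x * F' l x = F l x * S' l x" if "x \<in> {0..T}" for x
    by (rule sl_two_spectra_cross_product[OF T p p' Y Y' D N F F' S S' that])
  have FF: "F l x = F' l x" if x: "x \<in> {0<..<T}" for x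
  proof -
    have xc: "x \<in> {0..T}" using x by auto
    have W: "F l x * Sd l x - Fd l x * S l x = 1" "F' l x * Sd' l x - Fd' l x * S' l x = 1"
      using sl_sol_wronskian_const[OF f(1) s(1) xc] sl_sol_wronskian_const[OF f'(1) s'(1) xc] f f' s s'
      by auto
    note d = sl_solD(3)[OF f(1) x] sl_solD(3)[OF f'(1) x] sl_solD(3)[OF s(1) x] sl_solD(3)[OF s'(1) x]
    have "((\<lambda>x. S l x * F' l x) has_vector_derivative (S l x * Fd' l x + Sd l x * F' l x)) (at x)"
      by (intro has_vector_derivative_mult d)
    then have "((\<lambda>x. F l x * S' l x) has_vector_derivative (S l x * Fd' l x + Sd l x * F' l x)) (at x)"
      by (rule has_vector_derivative_transform_within_open[where S = "{0<..<T}"]) (use x cross in auto)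
    moreover have "((\<lambda>x. F l x * S' l x) has_vector_derivative (F l x * Sd' l x + Fd l x * S' l x)) (at x)"
      by (intro has_vector_derivative_mult d)
    ultimately have cross': "S l x * Fd' l x + Sd l x * F' l x = F l x * Sd' l x + Fd l x * S' l x"
      by (rule vector_derivative_unique_at)
    note c0 = cross[OF xc]
    \<comment> \<open>The right side combines the cross relation and its derivative, so it is 0; on
      the left both Wronskians are 1.\<close>
    have "(F' l x)\<^sup>2 * (F l x * Sd l x - Fd l x * S l x) - (F l x)\<^sup>2 * (F' l x * Sd' l x - Fd' l x * S' l x)
       = F l x * F' l x * ((S l x * Fd' l x + Sd l x * F' l x) - (F l x * Sd' l x + Fd l x * S' l x))
         - (F l x * Fd' l x + F' l x * Fd l x) * (S l x * F' l x - F l x * S' l x)"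
      by (simp add: algebra_simps power2_eq_square)
    then have "(F' l x)\<^sup>2 = (F l x)\<^sup>2" using W cross' c0 by simp
    then have "(F l x - F' l x) * (F l x + F' l x) = 0" by (simp add: algebra_simps power2_eq_square)
    \<comment> \<open>The choice of \<open>l\<close> excludes
      \<open>F l x = - F' l x\<close>.\<close>
    then show ?thesis using nz(2)[OF xc] by simp
  qed
  have FFd: "Fd l x = Fd' l x" if x: "x \<in> {0<..<T}" for x
  proof -
    have "(F' l has_vector_derivative Fd l x) (at x)"
      by (rule has_vector_derivative_transform_within_open[OF sl_solD(3)[OF f(1) x], where S = "{0<..<T}"])
        (use x FF in auto)
    then show ?thesis by (rule vector_derivative_unique_at) (rule sl_solD(3)[OF f'(1) x])
  qed
  show pp: "p x = p' x" if x: "x \<in> {0<..<T}" for x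
  proof -
    have "(Fd' l has_vector_derivative (of_real (p x) - l) * F l x) (at x)"
      by (rule has_vector_derivative_transform_within_open[OF sl_solD(4)[OF f(1) x], where S = "{0<..<T}"])
        (use x FFd in auto)
    then have "(of_real (p x) - l) * F l x = (of_real (p' x) - l) * F' l x"
      by (rule vector_derivative_unique_at) (rule sl_solD(4)[OF f'(1) x])
    then show ?thesis using FF[OF x] nz(1)[of x] x by simp
  qed
  have cl: "closure {0<..<T} = {0..T}" using T by (simp add: closure_greaterThanLessThan)
  \<comment> \<open>Equality of the derivatives extends from the open interval to 0, where their
    values are \<open>h\<close> and \<open>h'\<close>.\<close>
  have "Fd l 0 - Fd' l 0 = 0"
    by (rule continuous_constant_on_closure[where S = "{0<..<T}" and f = "\<lambda>x. Fd l x - Fd' l x"])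
      (use T FFd in \<open>auto simp: cl intro!: continuous_intros sl_solD(2)[OF f(1)] sl_solD(2)[OF f'(1)]\<close>)
  then show hh: "h = h'" using f f' by simp
  \<comment> \<open>At parameter 0 the families \<open>Y\<close> and \<open>Y'\<close> now have
    equal data at \<open>T\<close> and equal potentials. Uniqueness for the reflected equation
    carries the equality to 0, where \<open>U\<close> and \<open>U'\<close> take the values
    \<open>H\<close> and \<open>H'\<close>.\<close>
  have UT: "U 0 T = U' 0 T" using N[of 0] D[of 0] hh by simp
  have "- U 0 (T - T) = - U' 0 (T - T)"
  proof (rule sl_sol_unique(2)[where T = T and u = "\<lambda>x. - U 0 (T - x)" and v = "\<lambda>x. - U' 0 (T - x)"])
    show "sl_sol T (\<lambda>x. of_real (p x) - 0) (\<lambda>x. Y 0 (T - x)) (\<lambda>x. - U 0 (T - x))"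
      using sl_sol_reflect[OF sl_familyD(1)[OF Y, of 0]] by simp
    have "sl_sol T (\<lambda>x. of_real (p' x) - 0) (\<lambda>x. Y' 0 (T - x)) (\<lambda>x. - U' 0 (T - x))"
      using sl_sol_reflect[OF sl_familyD(1)[OF Y', of 0]] by simp
    then show "sl_sol T (\<lambda>x. of_real (p x) - 0) (\<lambda>x. Y' 0 (T - x)) (\<lambda>x. - U' 0 (T - x))"
      by (rule sl_sol_cong) (simp add: pp)
  qed (use T p D[of 0] UT in \<open>auto intro!: continuous_intros\<close>)
  then show "H = H'" using sl_familyD(3)[OF Y, of 0] sl_familyD(3)[OF Y', of 0] by simp
qed

section \<open>The conformable problem\<close>

lemma has_vector_derivative_iff_quotient:
  fixes f :: "real \<Rightarrow> complex"
  shows "(f has_vector_derivative d) (at x within S) \<longleftrightarrow>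
    ((\<lambda>y. (f y - f x) / of_real (y - x)) \<longlongrightarrow> d) (at x within S)"
proof -
  have "(f has_vector_derivative d) (at x within S) \<longleftrightarrow>
     ((\<lambda>y. (1 / norm (y - x)) *\<^sub>R (f y - (f x + (y - x) *\<^sub>R d))) \<longlongrightarrow> 0) (at x within S)"
    unfolding has_vector_derivative_def has_derivative_within by (simp add: bounded_linear_scaleR_left)
  also have "\<dots> \<longleftrightarrow> ((\<lambda>y. norm ((1 / norm (y - x)) *\<^sub>R (f y - (f x + (y - x) *\<^sub>R d)))) \<longlongrightarrow> 0) (at x within S)"
    by (rule tendsto_norm_zero_iff[symmetric])
  also have "\<dots> \<longleftrightarrow> ((\<lambda>y. norm ((f y - f x) / of_real (y - x) - d)) \<longlongrightarrow> 0) (at x within S)"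
  proof (rule Lim_cong_within)
    fix y assume "y \<noteq> x"
    then have "(f y - f x) / of_real (y - x) - d = (f y - (f x + (y - x) *\<^sub>R d)) / of_real (y - x)"
      by (simp add: scaleR_conv_of_real field_simps del: of_real_diff)
    then show "norm ((1 / norm (y - x)) *\<^sub>R (f y - (f x + (y - x) *\<^sub>R d))) = norm ((f y - f x) / of_real (y - x) - d)"
      by (simp add: norm_divide del: of_real_diff)
  qed auto
  also have "\<dots> \<longleftrightarrow> ((\<lambda>y. (f y - f x) / of_real (y - x)) \<longlongrightarrow> d) (at x within S)"
    unfolding tendsto_norm_zero_iff by (rule Lim_null[symmetric])
  finally show ?thesis .
qed

text \<open>The increment e moves x affinely with speed \<open>x powr (1 - \<alpha>)\<close>, which
  is nonzero for x > 0. The chain rule along this map \<open>s\<close> and along its inverse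
  \<open>r\<close> gives both directions, one-sided at pi.\<close>

lemma conf_deriv_at_iff:
  assumes x: "x \<in> {0<..pi}"
  shows "conf_deriv_at \<alpha> f d x \<longleftrightarrow>
    (f has_vector_derivative (x powr (\<alpha> - 1)) *\<^sub>R d) (at x within {0..pi})"
proof -
  define c where "c = x powr (1 - \<alpha>)"
  have c0: "c > 0" using x by (simp add: c_def)
  have ci: "x powr (\<alpha> - 1) = 1 / c" using x by (simp add: c_def powr_minus_divide[symmetric])
  define S where "S = {e. 0 \<le> x + e * c \<and> x + e * c \<le> pi}"
  define s where "s e = x + e * c" for e
  define r where "r y = (y - x) / c" for y
  have rs: "r (s e) = e" "s (r y) = y" for e y using c0 by (auto simp: r_def s_def)
  have sS: "s ` S = {0..pi}"
  proof safe
    fix y assume "y \<in> {0..pi}"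
    then have "r y \<in> S" using rs(2)[of y] by (simp add: S_def s_def)
    then show "y \<in> s ` S" by (metis rs(2) imageI)
  qed (auto simp: S_def s_def)
  have rS: "r ` {0..pi} = S" unfolding sS[symmetric] by (auto simp: image_image rs)
  have ds: "(s has_vector_derivative c) (at 0 within S)"
    unfolding s_def by (auto intro!: derivative_eq_intros simp flip: has_real_derivative_iff_has_vector_derivative)
  have dr: "(r has_vector_derivative 1 / c) (at x within {0..pi})"
    unfolding r_def using c0
    by (auto intro!: derivative_eq_intros simp flip: has_real_derivative_iff_has_vector_derivative)
  have "conf_deriv_at \<alpha> f d x \<longleftrightarrow> ((f \<circ> s) has_vector_derivative d) (at 0 within S)"
    unfolding conf_deriv_at_def has_vector_derivative_iff_quotient by (simp add: S_def s_def c_def)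
  also have "\<dots> \<longleftrightarrow> (f has_vector_derivative (1 / c) *\<^sub>R d) (at x within {0..pi})"
  proof
    assume "((f \<circ> s) has_vector_derivative d) (at 0 within S)"
    then have "((f \<circ> s) has_vector_derivative d) (at (r x) within r ` {0..pi})"
      by (simp add: rS) (simp add: r_def)
    from vector_diff_chain_within[OF dr this]
    show "(f has_vector_derivative (1 / c) *\<^sub>R d) (at x within {0..pi})"
      by (simp add: o_def rs)
  next
    assume "(f has_vector_derivative (1 / c) *\<^sub>R d) (at x within {0..pi})"
    then have "(f has_vector_derivative (1 / c) *\<^sub>R d) (at (s 0) within s ` S)"
      by (simp add: sS) (simp add: s_def)
    from vector_diff_chain_within[OF ds this]
    show "((f \<circ> s) has_vector_derivative d) (at 0 within S)" using c0 by simp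
  qed
  finally show ?thesis by (simp add: ci)
qed

text \<open>The substitution \<open>t = x\<^sup>\<alpha> / \<alpha>\<close>, under which the conformable derivative becomes \<open>d/dt\<close>.\<close>
definition conf_time :: "real \<Rightarrow> real \<Rightarrow> real" where
  "conf_time \<alpha> x = x powr \<alpha> / \<alpha>"

definition conf_time_inv :: "real \<Rightarrow> real \<Rightarrow> real" where
  "conf_time_inv \<alpha> t = (\<alpha> * t) powr (1 / \<alpha>)"

context
  fixes \<alpha> :: real
  assumes a0: "0 < \<alpha>"
begin

lemma conf_time_inverse: "0 \<le> x \<Longrightarrow> conf_time_inv \<alpha> (conf_time \<alpha> x) = x"
  and conf_time_inv_inverse: "0 \<le> t \<Longrightarrow> conf_time \<alpha> (conf_time_inv \<alpha> t) = t"
  using a0 by (auto simp: conf_time_def conf_time_inv_def powr_powr)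

lemma conf_time_mono: "0 \<le> x \<Longrightarrow> x \<le> y \<Longrightarrow> conf_time \<alpha> x \<le> conf_time \<alpha> y"
  using a0 by (auto simp: conf_time_def intro!: divide_right_mono powr_mono2)

lemma conf_time_strict_mono: "0 \<le> x \<Longrightarrow> x < y \<Longrightarrow> conf_time \<alpha> x < conf_time \<alpha> y"
  using a0 by (auto simp: conf_time_def intro!: divide_strict_right_mono powr_less_mono2)

lemma conf_time_0: "conf_time \<alpha> 0 = 0" "conf_time_inv \<alpha> 0 = 0"
  using a0 by (auto simp: conf_time_def conf_time_inv_def)

lemma conf_time_pi_pos: "0 < conf_time \<alpha> pi"
  using a0 by (simp add: conf_time_def)

lemma conf_time_in: "x \<in> {0..pi} \<Longrightarrow> conf_time \<alpha> x \<in> {0..conf_time \<alpha> pi}"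
  using conf_time_mono[of 0 x] conf_time_mono[of x pi] by (auto simp: conf_time_0)

lemma conf_time_in_interior: "x \<in> {0<..<pi} \<Longrightarrow> conf_time \<alpha> x \<in> {0<..<conf_time \<alpha> pi}"
  using conf_time_strict_mono[of 0 x] conf_time_strict_mono[of x pi] by (auto simp: conf_time_0)

lemma conf_time_inv_in:
  assumes "t \<in> {0..conf_time \<alpha> pi}"
  shows "conf_time_inv \<alpha> t \<in> {0..pi}"
proof -
  have "0 \<le> conf_time_inv \<alpha> t" by (simp add: conf_time_inv_def)
  moreover have "conf_time_inv \<alpha> t \<le> pi"
    using conf_time_strict_mono[of pi "conf_time_inv \<alpha> t"] conf_time_inv_inverse[of t] assms by force
  ultimately show ?thesis by simp
qed

lemma conf_time_inv_in_interior:
  assumes "t \<in> {0<..<conf_time \<alpha> pi}"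
  shows "conf_time_inv \<alpha> t \<in> {0<..<pi}"
proof -
  have "conf_time_inv \<alpha> t \<in> {0..pi}" by (rule conf_time_inv_in) (use assms in auto)
  moreover have "conf_time_inv \<alpha> t \<noteq> 0" "conf_time_inv \<alpha> t \<noteq> pi"
    using conf_time_inv_inverse[of t] assms conf_time_0 by auto
  ultimately show ?thesis by auto
qed

lemma conf_time_inv_pi: "conf_time_inv \<alpha> (conf_time \<alpha> pi) = pi"
  by (simp add: conf_time_inverse)

lemma continuous_on_conf_time: "continuous_on {0..b} (conf_time \<alpha>)"
  unfolding conf_time_def using a0 by (intro continuous_intros continuous_on_powr') auto

lemma continuous_on_conf_time_inv: "continuous_on {0..b} (conf_time_inv \<alpha>)"
  unfolding conf_time_inv_def using a0 by (intro continuous_intros continuous_on_powr') auto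

lemma has_vector_derivative_conf_time:
  assumes "0 < x"
  shows "(conf_time \<alpha> has_vector_derivative x powr (\<alpha> - 1)) (at x within A)"
  unfolding conf_time_def has_real_derivative_iff_has_vector_derivative[symmetric]
  using DERIV_cdivide[OF has_real_derivative_powr[OF assms, of \<alpha>], of \<alpha>] a0
  by (auto intro: has_field_derivative_at_within)

lemma has_vector_derivative_conf_time_inv:
  assumes "0 < t"
  shows "(conf_time_inv \<alpha> has_vector_derivative (conf_time_inv \<alpha> t) powr (1 - \<alpha>)) (at t)"
proof -
  have "((\<lambda>t. (\<alpha> * t) powr (1 / \<alpha>)) has_real_derivative
      ((1 / \<alpha>) * (\<alpha> * t) powr (1 / \<alpha> - 1)) * (\<alpha> * 1)) (at t)"
    by (rule DERIV_chain'[where f = "\<lambda>t. \<alpha> * t", OF DERIV_cmult[OF DERIV_ident] has_real_derivative_powr])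
      (use a0 assms in auto)
  \<comment> \<open>This exponent identity expresses the derivative through
    \<open>conf_time_inv \<alpha> t\<close>, in the form needed for cancellation against
    \<open>x powr (\<alpha> - 1)\<close>.\<close>
  moreover have "(1 / \<alpha>) * (1 - \<alpha>) = 1 / \<alpha> - 1" using a0 by (simp add: field_simps)
  ultimately show ?thesis
    unfolding conf_time_inv_def powr_powr
    using a0 by (simp add: has_real_derivative_iff_has_vector_derivative)
qed

text \<open>The speed \<open>x powr (1 - \<alpha>)\<close> of the inverse substitution cancels the
  factor \<open>x powr (\<alpha> - 1)\<close> between ordinary and conformable derivative.\<close>

lemma conf_sl_solution_imp_sl_sol:
  assumes "conf_sl_solution \<alpha> q lam y u"
  shows "sl_sol (conf_time \<alpha> pi) (\<lambda>t. of_real (q (conf_time_inv \<alpha> t)) - lam)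
    (\<lambda>t. y (conf_time_inv \<alpha> t)) (\<lambda>t. u (conf_time_inv \<alpha> t))"
proof -
  obtain v where yc: "continuous_on {0..pi} y" and uc: "continuous_on {0..pi} u"
    and y: "\<And>x. x \<in> {0<..pi} \<Longrightarrow> conf_deriv_at \<alpha> y (u x) x"
    and u: "\<And>x. x \<in> {0<..<pi} \<Longrightarrow> conf_deriv_at \<alpha> u (v x) x \<and>
            - v x + complex_of_real (q x) * y x = lam * y x"
    using assms unfolding conf_sl_solution_def by blast
  have chain: "((\<lambda>t. f (conf_time_inv \<alpha> t)) has_vector_derivative d) (at t)"
    if t: "t \<in> {0<..<conf_time \<alpha> pi}" and f: "conf_deriv_at \<alpha> f d (conf_time_inv \<alpha> t)" for f d t
  proof -
    define x where "x = conf_time_inv \<alpha> t"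
    have x: "x \<in> {0<..<pi}" unfolding x_def by (rule conf_time_inv_in_interior[OF t])
    then have "(f has_vector_derivative (x powr (\<alpha> - 1)) *\<^sub>R d) (at x)"
      using f conf_deriv_at_iff[of x \<alpha> f d] by (auto simp: x_def[symmetric] at_within_Icc_at)
    from vector_diff_chain_at[OF has_vector_derivative_conf_time_inv this[unfolded x_def]]
    have "(f \<circ> conf_time_inv \<alpha> has_vector_derivative
        (x powr (1 - \<alpha>) * x powr (\<alpha> - 1)) *\<^sub>R d) (at t)" using t by (simp add: x_def)
    moreover have "x powr (1 - \<alpha>) * x powr (\<alpha> - 1) = 1" using x by (simp flip: powr_add)
    ultimately show ?thesis by (simp add: o_def)
  qed
  show ?thesis unfolding sl_sol_def
  proof (intro conjI ballI)
    show "continuous_on {0..conf_time \<alpha> pi} (\<lambda>t. y (conf_time_inv \<alpha> t))"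
      "continuous_on {0..conf_time \<alpha> pi} (\<lambda>t. u (conf_time_inv \<alpha> t))"
      using conf_time_inv_in
      by (auto intro!: continuous_on_compose2[OF yc continuous_on_conf_time_inv]
          continuous_on_compose2[OF uc continuous_on_conf_time_inv])
    fix t assume t: "t \<in> {0<..<conf_time \<alpha> pi}"
    let ?x = "conf_time_inv \<alpha> t"
    have x: "?x \<in> {0<..<pi}" by (rule conf_time_inv_in_interior[OF t])
    show "((\<lambda>t. y (conf_time_inv \<alpha> t)) has_vector_derivative u ?x) (at t)"
      by (rule chain[OF t y]) (use x in auto)
    have "v ?x = (of_real (q ?x) - lam) * y ?x" using u[OF x] by (simp add: algebra_simps)
    then show "((\<lambda>t. u (conf_time_inv \<alpha> t)) has_vector_derivative (of_real (q ?x) - lam) * y ?x) (at t)"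
      using chain[OF t, of u "v ?x"] u[OF x] by simp
  qed
qed

lemma sl_sol_imp_conf_sl_solution:
  assumes sol: "sl_sol (conf_time \<alpha> pi) (\<lambda>t. of_real (q (conf_time_inv \<alpha> t)) - lam) z w"
    and nz: "\<exists>t\<in>{0..conf_time \<alpha> pi}. z t \<noteq> 0"
  shows "conf_sl_solution \<alpha> q lam (\<lambda>x. z (conf_time \<alpha> x)) (\<lambda>x. w (conf_time \<alpha> x))"
proof -
  let ?T = "conf_time \<alpha> pi"
  have im: "conf_time \<alpha> ` {0..pi} \<subseteq> {0..?T}" using conf_time_in by blast
  have chain: "conf_deriv_at \<alpha> (\<lambda>x. f (conf_time \<alpha> x)) d x"
    if x: "x \<in> {0<..pi}" and f: "(f has_vector_derivative d) (at (conf_time \<alpha> x) within {0..?T})" for f d x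
  proof -
    have "(conf_time \<alpha> has_vector_derivative x powr (\<alpha> - 1)) (at x within {0..pi})"
      by (rule has_vector_derivative_conf_time) (use x in auto)
    from vector_diff_chain_within[OF this has_vector_derivative_within_subset[OF f im]]
    show ?thesis using conf_deriv_at_iff[OF x] by (simp add: o_def)
  qed
  \<comment> \<open>The conformable equation for y is required at x = pi as well, so a one-sided
    derivative at the right end is needed; it comes from the integral of the continuous function
    \<open>w\<close>.\<close>
  have dz: "(z has_vector_derivative w t) (at t within {0..?T})" if t: "t \<in> {0..?T}" for t
  proof -
    have "((\<lambda>t. z 0 + integral {0..t} w) has_vector_derivative 0 + w t) (at t within {0..?T})"
      by (intro derivative_intros integral_has_vector_derivative sl_solD(2)[OF sol] t)
    then have "((\<lambda>t. z 0 + integral {0..t} w) has_vector_derivative w t) (at t within {0..?T})" by simp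
    moreover have "z s = z 0 + integral {0..s} w" if "s \<in> {0..?T}" for s
      using integral_unique[OF sl_sol_integral(1)[OF sol that]] by simp
    ultimately show ?thesis
      by (rule has_vector_derivative_transform[OF t, rotated])
  qed
  show ?thesis unfolding conf_sl_solution_def
  proof (intro conjI)
    obtain t where t: "t \<in> {0..?T}" "z t \<noteq> 0" using nz by blast
    then show "\<exists>x\<in>{0..pi}. z (conf_time \<alpha> x) \<noteq> 0"
      using conf_time_inv_in[OF t(1)] conf_time_inv_inverse[of t] by (intro bexI[of _ "conf_time_inv \<alpha> t"]) auto
    show "continuous_on {0..pi} (\<lambda>x. z (conf_time \<alpha> x))" "continuous_on {0..pi} (\<lambda>x. w (conf_time \<alpha> x))"
      by (intro continuous_on_compose2[OF sl_solD(1)[OF sol] continuous_on_conf_time im]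
        continuous_on_compose2[OF sl_solD(2)[OF sol] continuous_on_conf_time im])+
    show "\<forall>x\<in>{0<..pi}. conf_deriv_at \<alpha> (\<lambda>x. z (conf_time \<alpha> x)) (w (conf_time \<alpha> x)) x"
      using chain dz conf_time_in by auto
    show "\<exists>v. \<forall>x\<in>{0<..<pi}. conf_deriv_at \<alpha> (\<lambda>x. w (conf_time \<alpha> x)) (v x) x \<and>
       - v x + complex_of_real (q x) * z (conf_time \<alpha> x) = lam * z (conf_time \<alpha> x)"
    proof (intro exI ballI conjI)
      fix x assume x: "x \<in> {0<..<pi}"
      let ?v = "\<lambda>x. (of_real (q x) - lam) * z (conf_time \<alpha> x)"
      show "conf_deriv_at \<alpha> (\<lambda>x. w (conf_time \<alpha> x)) (?v x) x"
      proof (rule chain)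
        have "(w has_vector_derivative ?v x) (at (conf_time \<alpha> x))"
          using sl_solD(4)[OF sol conf_time_in_interior[OF x]] x by (simp add: conf_time_inverse)
        then show "(w has_vector_derivative ?v x) (at (conf_time \<alpha> x) within {0..?T})"
          by (rule has_vector_derivative_at_within)
      qed (use x in auto)
      show "- ?v x + complex_of_real (q x) * z (conf_time \<alpha> x) = lam * z (conf_time \<alpha> x)"
        by (simp add: algebra_simps)
    qed
  qed
qed

text \<open>The condition at pi makes every eigenfunction a multiple of the reflected
  \<open>Y lam\<close>, so only the condition at 0 remains. The coefficients \<open>A\<close> and
  \<open>B\<close> cover both kinds of condition there.\<close>

lemma conf_sl_boundary_iff:
  assumes q: "continuous_on {0..pi} q"
    and Y: "sl_family (conf_time \<alpha> pi) (\<lambda>t. q (conf_time_inv \<alpha> (conf_time \<alpha> pi - t))) 1 (of_real H) Y U"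
  shows "(\<exists>y u. conf_sl_solution \<alpha> q lam y u \<and> A * y 0 + B * u 0 = 0 \<and> u pi + complex_of_real H * y pi = 0)
    \<longleftrightarrow> A * Y lam (conf_time \<alpha> pi) - B * U lam (conf_time \<alpha> pi) = 0"
proof -
  let ?T = "conf_time \<alpha> pi"
  have T: "0 < ?T" by (rule conf_time_pi_pos)
  note Yl = sl_familyD[OF Y, of lam]
  have qc: "continuous_on {0..?T} (\<lambda>t. complex_of_real (q (conf_time_inv \<alpha> (?T - t))) - lam)"
  proof (intro continuous_intros)
    have "continuous_on {0..?T} (\<lambda>t. conf_time_inv \<alpha> (?T - t))"
      by (intro continuous_on_compose2[OF continuous_on_conf_time_inv] continuous_intros) auto
    then show "continuous_on {0..?T} (\<lambda>t. q (conf_time_inv \<alpha> (?T - t)))"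
      by (rule continuous_on_compose2[OF q]) (use conf_time_inv_in in force)
  qed
  show ?thesis
  proof
    assume "\<exists>y u. conf_sl_solution \<alpha> q lam y u \<and> A * y 0 + B * u 0 = 0 \<and> u pi + complex_of_real H * y pi = 0"
    then obtain y u where sol: "conf_sl_solution \<alpha> q lam y u" and b0: "A * y 0 + B * u 0 = 0"
      and b1: "u pi + complex_of_real H * y pi = 0" by blast
    let ?z = "\<lambda>t. y (conf_time_inv \<alpha> (?T - t))" and ?w = "\<lambda>t. - u (conf_time_inv \<alpha> (?T - t))"
    have zw: "sl_sol ?T (\<lambda>t. of_real (q (conf_time_inv \<alpha> (?T - t))) - lam) ?z ?w"
      using sl_sol_reflect[OF conf_sl_solution_imp_sl_sol[OF sol]] by simp
    \<comment> \<open>The zero summand only brings the multiple \<open>y pi * Y lam\<close> into the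
      shape of a linear combination.\<close>
    have cY: "sl_sol ?T (\<lambda>t. of_real (q (conf_time_inv \<alpha> (?T - t))) - lam)
       (\<lambda>t. y pi * Y lam t + 0 * Y lam t) (\<lambda>t. y pi * U lam t + 0 * U lam t)"
      by (rule sl_sol_lincomb[OF Yl(1) Yl(1)])
    have init: "?z 0 = y pi * Y lam 0 + 0 * Y lam 0" "?w 0 = y pi * U lam 0 + 0 * U lam 0"
      using b1 by (auto simp: Yl conf_time_inv_pi algebra_simps add_eq_0_iff)
    have eq: "?z t = y pi * Y lam t" "?w t = y pi * U lam t" if "t \<in> {0..?T}" for t
      using sl_sol_unique[OF zw cY qc init that] by auto
    \<comment> \<open>Otherwise \<open>y\<close> would vanish identically.\<close>
    have "y pi \<noteq> 0"
    proof
      assume 0: "y pi = 0"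
      obtain x where x: "x \<in> {0..pi}" "y x \<noteq> 0" using sol unfolding conf_sl_solution_def by blast
      have "?T - conf_time \<alpha> x \<in> {0..?T}" using conf_time_in[OF x(1)] by auto
      from eq(1)[OF this] 0 x show False by (simp add: conf_time_inverse)
    qed
    moreover have y0: "y 0 = y pi * Y lam ?T" and u0: "u 0 = - (y pi * U lam ?T)"
      using eq[of ?T] T by (auto simp: conf_time_0 minus_equation_iff[of "u 0"])
    have "y pi * (A * Y lam ?T - B * U lam ?T) = A * y 0 + B * u 0"
      unfolding y0 u0 by (simp add: algebra_simps)
    ultimately show "A * Y lam ?T - B * U lam ?T = 0" using b0 by auto
  next
    assume 0: "A * Y lam ?T - B * U lam ?T = 0"
    have sol: "sl_sol ?T (\<lambda>t. of_real (q (conf_time_inv \<alpha> t)) - lam) (\<lambda>t. Y lam (?T - t)) (\<lambda>t. - U lam (?T - t))"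
      using sl_sol_reflect[OF Yl(1)] by simp
    \<comment> \<open>Nontriviality is witnessed at \<open>t = T\<close>, where the reflected
      solution equals \<open>Y lam 0 = 1\<close>.\<close>
    have "conf_sl_solution \<alpha> q lam (\<lambda>x. Y lam (?T - conf_time \<alpha> x)) (\<lambda>x. - U lam (?T - conf_time \<alpha> x))"
      by (rule sl_sol_imp_conf_sl_solution[OF sol]) (use T Yl in \<open>auto intro!: bexI[of _ ?T]\<close>)
    moreover have "A * Y lam (?T - conf_time \<alpha> 0) + B * (- U lam (?T - conf_time \<alpha> 0)) = 0"
      using 0 by (simp add: conf_time_0)
    moreover have "- U lam (?T - conf_time \<alpha> pi) + complex_of_real H * Y lam (?T - conf_time \<alpha> pi) = 0"
      by (simp add: Yl)
    ultimately show "\<exists>y u. conf_sl_solution \<alpha> q lam y u \<and> A * y 0 + B * u 0 = 0 \<and> u pi + complex_of_real H * y pi = 0"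
      by (intro exI conjI)
  qed
qed

lemma eig_L_iff:
  assumes "continuous_on {0..pi} q"
    and "sl_family (conf_time \<alpha> pi) (\<lambda>t. q (conf_time_inv \<alpha> (conf_time \<alpha> pi - t))) 1 (of_real H) Y U"
  shows "lam \<in> eig_L \<alpha> q h H \<longleftrightarrow> of_real h * Y lam (conf_time \<alpha> pi) + U lam (conf_time \<alpha> pi) = 0"
    and "lam \<in> eig_L1 \<alpha> q H \<longleftrightarrow> Y lam (conf_time \<alpha> pi) = 0"
proof -
  have "u - of_real h * y = 0 \<longleftrightarrow> of_real h * y + (- 1) * u = 0" for u y :: complex by auto
  then show "lam \<in> eig_L \<alpha> q h H \<longleftrightarrow> of_real h * Y lam (conf_time \<alpha> pi) + U lam (conf_time \<alpha> pi) = 0"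
    using conf_sl_boundary_iff[OF assms, of lam "of_real h" "- 1"] by (simp add: eig_L_def)
  show "lam \<in> eig_L1 \<alpha> q H \<longleftrightarrow> Y lam (conf_time \<alpha> pi) = 0"
    using conf_sl_boundary_iff[OF assms, of lam 1 0] by (simp add: eig_L1_def)
qed

end

theorem theorem2:
  fixes \<alpha> h H h' H' :: real and q q' :: "real \<Rightarrow> real"
    and lam xi lam' xi' :: "nat \<Rightarrow> real"
  assumes "0 < \<alpha>" "\<alpha> \<le> 1"
    and "continuous_on {0..pi} q" "continuous_on {0..pi} q'"
    and "enumerates_incr lam (eig_L \<alpha> q h H)"
    and "enumerates_incr xi (eig_L1 \<alpha> q H)"
    and "enumerates_incr lam' (eig_L \<alpha> q' h' H')"
    and "enumerates_incr xi' (eig_L1 \<alpha> q' H')"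
    and "\<forall>n. lam n = lam' n" and "\<forall>n. xi n = xi' n"
  shows "(AE x in lborel. x \<in> {0..pi} \<longrightarrow> q x = q' x) \<and> h = h' \<and> H = H'"
proof -
  note a0 = \<open>0 < \<alpha>\<close>
  define T where "T = conf_time \<alpha> pi"
  have T: "0 < T" unfolding T_def by (rule conf_time_pi_pos[OF a0])
  have "lam = lam'" "xi = xi'" using assms(9,10) by auto
  \<comment> \<open>The enumerations give equality of the spectra as sets, and their
    reality.\<close>
  then have eqN: "eig_L \<alpha> q h H = eig_L \<alpha> q' h' H'" and eqD: "eig_L1 \<alpha> q H = eig_L1 \<alpha> q' H'"
    and reN: "eig_L \<alpha> q h H \<subseteq> \<real>" and reD: "eig_L1 \<alpha> q H \<subseteq> \<real>"
    using assms(5-8) by (auto simp: enumerates_incr_def)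
  have cont: "continuous_on {0..T} (\<lambda>t. r (conf_time_inv \<alpha> t))"
    "continuous_on {0..T} (\<lambda>t. r (conf_time_inv \<alpha> (T - t)))" if r: "continuous_on {0..pi} r" for r :: "real \<Rightarrow> real"
  proof -
    show c: "continuous_on {0..T} (\<lambda>t. r (conf_time_inv \<alpha> t))"
      unfolding T_def
      by (rule continuous_on_compose2[OF r continuous_on_conf_time_inv[OF a0]])
        (use conf_time_inv_in[OF a0] in blast)
    show "continuous_on {0..T} (\<lambda>t. r (conf_time_inv \<alpha> (T - t)))"
      by (rule continuous_on_compose2[OF c]) (auto intro!: continuous_intros)
  qed
  obtain Y U where Y: "sl_family T (\<lambda>t. q (conf_time_inv \<alpha> (T - t))) 1 (of_real H) Y U"
    using sl_family_exists[OF T cont(2)[OF assms(3)]] by blast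
  obtain Y' U' where Y': "sl_family T (\<lambda>t. q' (conf_time_inv \<alpha> (T - t))) 1 (of_real H') Y' U'"
    using sl_family_exists[OF T cont(2)[OF assms(4)]] by blast
  note e = eig_L_iff[OF a0 assms(3) Y[unfolded T_def], folded T_def]
  note e' = eig_L_iff[OF a0 assms(4) Y'[unfolded T_def], folded T_def]
  have zD: "Y l T = 0 \<longleftrightarrow> Y' l T = 0" and rD: "Y l T = 0 \<Longrightarrow> l \<in> \<real>" for l
    using eqD reD e(2)[of l] e'(2)[of l] by auto
  have zN: "of_real h * Y l T + U l T = 0 \<longleftrightarrow> of_real h' * Y' l T + U' l T = 0"
    and rN: "of_real h * Y l T + U l T = 0 \<Longrightarrow> l \<in> \<real>" for l
    using eqN reN e(1)[of l h] e'(1)[of l h'] by auto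
  note result = sl_two_spectra[OF T cont(1)[OF assms(3)] cont(1)[OF assms(4)] Y Y' zD rD zN rN]
  have "q x = q' x" if "x \<in> {0<..<pi}" for x
    using result(1)[of "conf_time \<alpha> x"] conf_time_in_interior[OF a0 that] that
    by (simp add: T_def conf_time_inverse[OF a0])
  \<comment> \<open>The equality is known at interior points; the two endpoints form a null
    set.\<close>
  then have qq: "x \<in> {0..pi} \<longrightarrow> q x = q' x" if "x \<noteq> 0" "x \<noteq> pi" for x
    using that by auto
  have "AE x in lborel. x \<in> {0..pi} \<longrightarrow> q x = q' x"
    using AE_lborel_singleton[of "0::real"] AE_lborel_singleton[of pi] by eventually_elim (rule qq)
  then show ?thesis using result(2,3) by blast
qed

end
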